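(* For every positive integer $n$, the number of elements in the congruence lattice of $\operatorname{esTam}_n$ equals the sum, over all Dyck paths from $(0,0)$ to $(2n,0)$, of the weight of the path, where the weight of a Dyck path is the product of the weights $\operatorname{wt}(c)$ of all cells $c$ below the path, with $$\operatorname{wt}(c)=\begin{cases}3&\text{if } c\text{ is a corner cell of height }1,\\2&\text{if } c\text{ is a boundary cell of height }1,\\1&\text{if } c\text{ is an inner cell of height }1,\\7&\text{if } c\text{ is a corner cell of height}>1,\\4&\text{if } c\text{ is a boundary cell of height}>1,\\2&\text{if } c\text{ is an inner cell of height}>1.\end{cases}$$
   Context: Let $n$ be a positive integer. The board of size $n$ is the Ferrers diagram of shape $(n,n,n-1,n-2,\dots,3,2)$ (a single cell $(1,1)$ if $n=1$). Its cells are written $(i,j)$, where $i$ is the row, numbered from the top, and $j$ is the column label, the columns being labelled $n,n-1,\dots,1$ from left to right. So the cells are $(1,j)$ for $1\le j\le n$ and $(i,j)$ for $2\le i\le n$, $i-1\le j\le n$. The root is $(1,n)$ (top-left cell); the border cells are $(i,i-1)$ for $2\le i\le n$ (the rightmost cells of rows $2,\dots,n$). An fb-tableau of size $n$ is a filling in which each cell is either empty or nonempty such that the root and all border cells are nonempty, and every nonempty cell other than the root has a nonempty cell strictly to its left in the same row or strictly above it in the same column. In an fb-tableau, a nonempty cell different from the root is called a left-arrow if there is no nonempty cell strictly to its left in its row, an up-arrow if there is no nonempty cell strictly above it in its column, and a dot otherwise; the root is also a dot. (Each of rows $2,\dots,n$ has exactly one left-arrow, each of columns $1,\dots,n-1$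 has exactly one up-arrow.) A cell is free in $T$ if it lies strictly below an up-arrow (same column) and strictly to the right of a left-arrow (same row); a free cell is either empty or contains a dot. $\operatorname{Row}(T)$ is the set of cells lying weakly to the right of a left-arrow or of the root in the same row; $\operatorname{Col}(T)$ is the set of cells lying weakly below an up-arrow or the root in the same column. For fb-tableaux $S,T$ of size $n$, write $S\lhd T$ if (1) $\operatorname{Col}(S)\subseteq\operatorname{Col}(T)$; (2) $\operatorname{Row}(T)\subseteq\operatorname{Row}(S)$; (3) for every cell $c$ that is free in both $S$ and $T$, if $c$ contains a dot in $S$ then $c$ contains a dot in $T$. The extra slow Tamari lattice $\operatorname{esTam}_n$ is the set of fb-tableaux of size $n$ ordered by $\lhd$; it is a finite lattice. A congruence of a lattice is an equivalence relation compatible with $\wedge$ and $\vee$; the congruence lattice is the set of all congruences ordered by inclusion. Dyck paths: steps $(1,1)$ and $(1,-1)$, from $(0,0)$ to $(2n,0)$, never going below the $x$-axis. A cell (of the path picture) is a unit diamond with vertices $(a,h-1),(a-1,h),(a,h+1),(a+1,h)$, with $a,h$ integers, $h\ge1$ and $a+h$ odd; $h$ is its height. It is below the path if it lies weakly below the path, i.e. the height of the path at abscissa $a$ is at least $h+1$. A cell below the path is a corner cell if both of its upper edges (the segments from $(a-1,h)$ to $(a,h+1)$ and from $(a,h+1)$ to $(a+1,h)$) are steps of the path, a boundary cell if exactly one of them is, and an inner cell if neither is. *)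

theory Defs
  imports "HOL-Algebra.Lattice"
begin

section \<open>Fb-tableaux\<close>

text \<open>
  A cell is a pair \<open>(i, j)\<close> of its row and its column label. Rows are numbered from the top, but
  column labels decrease from left to right, so that \<open>(i, k)\<close> lies strictly to the left of
  \<open>(i, j)\<close> iff \<open>k > j\<close>. A filling of the board is represented by its set of nonempty cells.
\<close>

type_synonym cell = "nat \<times> nat"

definition board :: "nat \<Rightarrow> cell set" where
  "board n = {(i, j). i = 1 \<and> 1 \<le> j \<and> j \<le> n} \<union> {(i, j). 2 \<le> i \<and> i \<le> n \<and> i - 1 \<le> j \<and> j \<le> n}"

definition root :: "nat \<Rightarrow> cell" where
  "root n = (1, n)"

definition border :: "nat \<Rightarrow> cell set" where
  "border n = {(i, i - 1) | i. 2 \<le> i \<and> i \<le> n}"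

definition has_left :: "cell set \<Rightarrow> cell \<Rightarrow> bool" where
  "has_left T c \<longleftrightarrow> (\<exists>k > snd c. (fst c, k) \<in> T)"

definition has_above :: "cell set \<Rightarrow> cell \<Rightarrow> bool" where
  "has_above T c \<longleftrightarrow> (\<exists>k < fst c. (k, snd c) \<in> T)"

definition fb_tableau :: "nat \<Rightarrow> cell set \<Rightarrow> bool" where
  "fb_tableau n T \<longleftrightarrow>
     T \<subseteq> board n \<and> root n \<in> T \<and> border n \<subseteq> T \<and>
     (\<forall>c \<in> T - {root n}. has_left T c \<or> has_above T c)"

definition left_arrow :: "nat \<Rightarrow> cell set \<Rightarrow> cell \<Rightarrow> bool" where
  "left_arrow n T c \<longleftrightarrow> c \<in> T \<and> c \<noteq> root n \<and> \<not> has_left T c"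

definition up_arrow :: "nat \<Rightarrow> cell set \<Rightarrow> cell \<Rightarrow> bool" where
  "up_arrow n T c \<longleftrightarrow> c \<in> T \<and> c \<noteq> root n \<and> \<not> has_above T c"

definition is_dot :: "nat \<Rightarrow> cell set \<Rightarrow> cell \<Rightarrow> bool" where
  "is_dot n T c \<longleftrightarrow> c \<in> T \<and> \<not> left_arrow n T c \<and> \<not> up_arrow n T c"

definition free_cell :: "nat \<Rightarrow> cell set \<Rightarrow> cell \<Rightarrow> bool" where
  "free_cell n T c \<longleftrightarrow>
     c \<in> board n \<and> (\<exists>k < fst c. up_arrow n T (k, snd c)) \<and> (\<exists>k > snd c. left_arrow n T (fst c, k))"

definition Row :: "nat \<Rightarrow> cell set \<Rightarrow> cell set" where
  "Row n T = {(i, j) \<in> board n. \<exists>k \<ge> j. left_arrow n T (i, k) \<or> (i, k) = root n}"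

definition Col :: "nat \<Rightarrow> cell set \<Rightarrow> cell set" where
  "Col n T = {(i, j) \<in> board n. \<exists>k \<le> i. up_arrow n T (k, j) \<or> (k, j) = root n}"

definition tableau_le :: "nat \<Rightarrow> cell set \<Rightarrow> cell set \<Rightarrow> bool" where
  "tableau_le n S T \<longleftrightarrow>
     Col n S \<subseteq> Col n T \<and> Row n T \<subseteq> Row n S \<and>
     (\<forall>c. free_cell n S c \<and> free_cell n T c \<and> is_dot n S c \<longrightarrow> is_dot n T c)"

definition esTam :: "nat \<Rightarrow> cell set gorder" where
  "esTam n = \<lparr>carrier = {T. fb_tableau n T}, eq = (=), le = tableau_le n\<rparr>"


section \<open>Congruences of a lattice\<close>

definition lattice_congruence :: "('a, 'b) gorder_scheme \<Rightarrow> ('a \<times> 'a) set \<Rightarrow> bool" where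
  "lattice_congruence L R \<longleftrightarrow>
     equiv (carrier L) R \<and>
     (\<forall>(x, x') \<in> R. \<forall>(y, y') \<in> R.
        (x \<sqinter>\<^bsub>L\<^esub> y, x' \<sqinter>\<^bsub>L\<^esub> y') \<in> R \<and> (x \<squnion>\<^bsub>L\<^esub> y, x' \<squnion>\<^bsub>L\<^esub> y') \<in> R)"

definition congruence_lattice :: "('a, 'b) gorder_scheme \<Rightarrow> ('a \<times> 'a) set gorder" where
  "congruence_lattice L = \<lparr>carrier = {R. lattice_congruence L R}, eq = (=), le = (\<subseteq>)\<rparr>"


section \<open>Dyck paths and their weights\<close>

text \<open>
  A path is the list of the vertical components of its steps: \<open>1\<close> stands for the step \<open>(1, 1)\<close>
  and \<open>-1\<close> for the step \<open>(1, -1)\<close>.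
\<close>

definition path_height :: "int list \<Rightarrow> nat \<Rightarrow> int" where
  "path_height p a = sum_list (take a p)"

definition dyck_paths :: "nat \<Rightarrow> int list set" where
  "dyck_paths n =
     {p. length p = 2 * n \<and> set p \<subseteq> {1, -1} \<and>
         (\<forall>a \<le> 2 * n. path_height p a \<ge> 0) \<and> path_height p (2 * n) = 0}"

text \<open>
  The unit diamond with vertices \<open>(a, h - 1)\<close>, \<open>(a - 1, h)\<close>, \<open>(a, h + 1)\<close>, \<open>(a + 1, h)\<close> is
  represented by \<open>(a, h)\<close>. A cell below a Dyck path satisfies \<open>0 < a < length p\<close>, because the
  path has height at least \<open>2\<close> at \<open>a\<close>; hence the subtraction in \<open>a - 1\<close> below never truncates.
\<close>

definition cells_below :: "int list \<Rightarrow> (nat \<times> int) set" where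
  "cells_below p =
     {(a, h). a \<le> length p \<and> h \<ge> 1 \<and> odd (int a + h) \<and> path_height p a \<ge> h + 1}"

definition upper_left_on_path :: "int list \<Rightarrow> nat \<times> int \<Rightarrow> bool" where
  "upper_left_on_path p = (\<lambda>(a, h). path_height p (a - 1) = h \<and> path_height p a = h + 1)"

definition upper_right_on_path :: "int list \<Rightarrow> nat \<times> int \<Rightarrow> bool" where
  "upper_right_on_path p = (\<lambda>(a, h). path_height p a = h + 1 \<and> path_height p (a + 1) = h)"

definition corner_cell :: "int list \<Rightarrow> nat \<times> int \<Rightarrow> bool" where
  "corner_cell p c \<longleftrightarrow> upper_left_on_path p c \<and> upper_right_on_path p c"

definition boundary_cell :: "int list \<Rightarrow> nat \<times> int \<Rightarrow> bool" where
  "boundary_cell p c \<longleftrightarrow> upper_left_on_path p c \<noteq> upper_right_on_path p c"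

definition cell_weight :: "int list \<Rightarrow> nat \<times> int \<Rightarrow> nat" where
  "cell_weight p c =
     (if snd c = 1
      then if corner_cell p c then 3 else if boundary_cell p c then 2 else 1
      else if corner_cell p c then 7 else if boundary_cell p c then 4 else 2)"

definition path_weight :: "int list \<Rightarrow> nat" where
  "path_weight p = (\<Prod>c \<in> cells_below p. cell_weight p c)"

end

theory Submission
  imports Defs
begin

text \<open>
  A tableau is encoded by recording, for each cell outside the first row and the leftmost column,
  whether it has a nonempty cell above it, whether it has none to its left, and whether it
  contains a dot. This identifies the lattice with the closed sets of a closure system in which
  the only rule with two premises says that \<open>(Gamma, i, j')\<close> and \<open>(Beta, i + 1, j)\<close> with \<open>j' < j\<close>
  imply \<open>(Gamma, i, j)\<close>. A congruence is determined by the set \<open>U\<close> of the join-irreducibles that it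
  does not collapse to their lower covers. The sets \<open>U\<close> that arise are those containing, with any element at a cell
  \<open>(i, j)\<close>, \<open>i \<le> j\<close>, also \<open>(Gamma, i, j - 1)\<close> and \<open>(Beta, i + 1, j)\<close>. The cells occurring
  in \<open>U\<close> form an order ideal of the triangle of cells, that is, a Dyck path. Given this ideal, the
  choices at the various cells are independent, and their numbers are the weights.
\<close>

section \<open>Congruences of a lattice of closed sets\<close>

text \<open>Restricting closed sets to \<open>U\<close> always respects meets, which are
  intersections. Joins are the obstacle: the closure of a union may contain an element of
  \<open>U\<close> whose derivation passes through elements outside \<open>U\<close>, and then the
  traces of the two arguments do not determine the trace of the join. So whatever the two-premise
  rule can produce in \<open>U\<close> must have its premises in \<open>U\<close>. The rule produces
  \<open>Gamma\<close> at \<open>(i, j)\<close> and with it everything below, so all kinds at that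
  cell make the same demand; this is why only the support of \<open>U\<close> matters for the
  demands. Asking for the nearest premise, at label \<open>j - 1\<close>, is enough, because
  iterating the demand reaches the farther ones. The constants count sets of kinds: 7 nonempty
  subsets of three kinds, 4 containing one prescribed kind, 2 containing two. At border cells, the
  diamonds of height 1, \<open>Delta\<close> is missing, and the numbers are 3, 2, 1. A kind is
  prescribed by each upper neighbour in the ideal, and an upper edge lies on the path exactly when
  the neighbour across it is missing.\<close>

text \<open>
  An element \<open>q\<close> of \<open>J\<close> stands for the join-irreducible \<open>down q\<close>, whose lower cover is
  \<open>down q - {q}\<close>.
\<close>

locale closure_representation =
  fixes L :: "('b, 'c) gorder_scheme"
    and f :: "'b \<Rightarrow> 'a set"
    and J :: "'a set"
    and \<F> :: "'a set set"
    and down :: "'a \<Rightarrow> 'a set"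
  assumes finite_J: "finite J"
    and subset_J: "F \<in> \<F> \<Longrightarrow> F \<subseteq> J"
    and J_mem: "J \<in> \<F>"
    and Inter_mem: "\<A> \<subseteq> \<F> \<Longrightarrow> \<A> \<noteq> {} \<Longrightarrow> \<Inter>\<A> \<in> \<F>"
    and self_mem_down: "q \<in> J \<Longrightarrow> q \<in> down q"
    and down_mem: "q \<in> J \<Longrightarrow> down q \<in> \<F>"
    and down_minus_mem: "q \<in> J \<Longrightarrow> down q - {q} \<in> \<F>"
    and down_subset: "F \<in> \<F> \<Longrightarrow> q \<in> F \<Longrightarrow> down q \<subseteq> F"
    and bij: "bij_betw f (carrier L) \<F>"
    and le_iff: "x \<in> carrier L \<Longrightarrow> y \<in> carrier L \<Longrightarrow> le L x y \<longleftrightarrow> f x \<subseteq> f y"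
begin

definition cl :: "'a set \<Rightarrow> 'a set" where
  "cl X = \<Inter>{F \<in> \<F>. X \<subseteq> F}"

text \<open>These are the unions of closed sets; their closures are the joins of the closed sets
  involved.\<close>

definition down_closed :: "'a set \<Rightarrow> bool" where
  "down_closed X \<longleftrightarrow> X \<subseteq> J \<and> (\<forall>q \<in> X. down q \<subseteq> X)"

text \<open>The part of a join that \<open>U\<close> sees must already follow from what
  \<open>U\<close> sees of the arguments. The opposite comparison,
  \<open>cl (X \<inter> U) \<subseteq> cl X\<close>, is plain monotonicity.\<close>

definition admissible :: "'a set \<Rightarrow> bool" where
  "admissible U \<longleftrightarrow> U \<subseteq> J \<and> (\<forall>X. down_closed X \<longrightarrow> cl X \<inter> U \<subseteq> cl (X \<inter> U))"

definition kernel :: "'a set \<Rightarrow> ('b \<times> 'b) set" where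
  "kernel U = {(x, y). x \<in> carrier L \<and> y \<in> carrier L \<and> f x \<inter> U = f y \<inter> U}"

section \<open>The closure operator and the lattice operations\<close>

lemma cl_mem: "X \<subseteq> J \<Longrightarrow> cl X \<in> \<F>"
  unfolding cl_def using J_mem by (intro Inter_mem) auto

lemma cl_upper: "X \<subseteq> cl X"
  unfolding cl_def by auto

lemma cl_least: "F \<in> \<F> \<Longrightarrow> X \<subseteq> F \<Longrightarrow> cl X \<subseteq> F"
  unfolding cl_def by auto

lemma cl_mono: "X \<subseteq> Y \<Longrightarrow> cl X \<subseteq> cl Y"
  unfolding cl_def by auto

lemma cl_id: "F \<in> \<F> \<Longrightarrow> cl F = F"
  using cl_least cl_upper by blast

lemma inter_mem: "F \<in> \<F> \<Longrightarrow> G \<in> \<F> \<Longrightarrow> F \<inter> G \<in> \<F>"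
  using Inter_mem[of "{F, G}"] by auto

lemma f_mem: "x \<in> carrier L \<Longrightarrow> f x \<in> \<F>"
  using bij by (auto simp: bij_betw_def)

lemma f_subset_J: "x \<in> carrier L \<Longrightarrow> f x \<subseteq> J"
  using f_mem subset_J by blast

lemma f_eqD: "f x = f y \<Longrightarrow> x \<in> carrier L \<Longrightarrow> y \<in> carrier L \<Longrightarrow> x = y"
  using bij by (auto simp: bij_betw_def inj_on_def)

lemma f_surj: "F \<in> \<F> \<Longrightarrow> \<exists>x \<in> carrier L. f x = F"
  using bij by (auto simp: bij_betw_def)

text \<open>\<open>meet\<close> is a Hilbert choice among greatest lower bounds, so a witness
  \<open>z\<close> is exhibited first; comparison with \<open>z\<close> then pins down the image of
  the chosen element. Joins are treated in the same way.\<close>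

lemma meet_rep:
  assumes x: "x \<in> carrier L" and y: "y \<in> carrier L"
  shows "x \<sqinter>\<^bsub>L\<^esub> y \<in> carrier L" "f (x \<sqinter>\<^bsub>L\<^esub> y) = f x \<inter> f y"
proof -
  have lower: "Lower L {x, y} = {v \<in> carrier L. f v \<subseteq> f x \<inter> f y}"
    unfolding Lower_def using x y le_iff by auto
  obtain z where z: "z \<in> carrier L" "f z = f x \<inter> f y"
    using f_surj[OF inter_mem[OF f_mem[OF x] f_mem[OF y]]] by blast
  have "greatest L z (Lower L {x, y})"
    unfolding greatest_def lower using z le_iff by auto
  then have "greatest L (x \<sqinter>\<^bsub>L\<^esub> y) (Lower L {x, y})"
    unfolding meet_def inf_def by (rule someI)
  then have m: "x \<sqinter>\<^bsub>L\<^esub> y \<in> carrier L" "f (x \<sqinter>\<^bsub>L\<^esub> y) \<subseteq> f x \<inter> f y" "le L z (x \<sqinter>\<^bsub>L\<^esub> y)"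
    unfolding greatest_def lower using z by auto
  then show "x \<sqinter>\<^bsub>L\<^esub> y \<in> carrier L" "f (x \<sqinter>\<^bsub>L\<^esub> y) = f x \<inter> f y"
    using le_iff[OF z(1) m(1)] z by auto
qed

lemma join_rep:
  assumes x: "x \<in> carrier L" and y: "y \<in> carrier L"
  shows "x \<squnion>\<^bsub>L\<^esub> y \<in> carrier L" "f (x \<squnion>\<^bsub>L\<^esub> y) = cl (f x \<union> f y)"
proof -
  have upper: "Upper L {x, y} = {v \<in> carrier L. cl (f x \<union> f y) \<subseteq> f v}"
  proof -
    have "cl (f x \<union> f y) \<subseteq> f v \<longleftrightarrow> f x \<subseteq> f v \<and> f y \<subseteq> f v" if "v \<in> carrier L" for v
      using cl_least[OF f_mem[OF that], of "f x \<union> f y"] cl_upper[of "f x \<union> f y"] by blast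
    then show ?thesis unfolding Upper_def using x y le_iff by auto
  qed
  have "cl (f x \<union> f y) \<in> \<F>" using cl_mem f_subset_J x y by simp
  then obtain z where z: "z \<in> carrier L" "f z = cl (f x \<union> f y)"
    using f_surj by blast
  have "least L z (Upper L {x, y})"
    unfolding least_def upper using z le_iff by auto
  then have "least L (x \<squnion>\<^bsub>L\<^esub> y) (Upper L {x, y})"
    unfolding join_def sup_def by (rule someI)
  then have m: "x \<squnion>\<^bsub>L\<^esub> y \<in> carrier L" "cl (f x \<union> f y) \<subseteq> f (x \<squnion>\<^bsub>L\<^esub> y)" "le L (x \<squnion>\<^bsub>L\<^esub> y) z"
    unfolding least_def upper using z by auto
  then show "x \<squnion>\<^bsub>L\<^esub> y \<in> carrier L" "f (x \<squnion>\<^bsub>L\<^esub> y) = cl (f x \<union> f y)"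
    using le_iff[OF m(1) z(1)] z by auto
qed

lemma down_closed_Un_closed: "F \<in> \<F> \<Longrightarrow> G \<in> \<F> \<Longrightarrow> down_closed (F \<union> G)"
  unfolding down_closed_def using subset_J down_subset by blast

section \<open>Admissible sets correspond to congruences\<close>

lemma kernel_congruence:
  assumes U: "admissible U"
  shows "lattice_congruence L (kernel U)"
proof -
  have join_trace: "cl (F \<union> G) \<inter> U = cl ((F \<inter> U) \<union> (G \<inter> U)) \<inter> U" if "F \<in> \<F>" "G \<in> \<F>" for F G
  proof -
    have "cl (F \<union> G) \<inter> U \<subseteq> cl ((F \<union> G) \<inter> U)"
      using U down_closed_Un_closed[OF that] unfolding admissible_def by blast
    moreover have "(F \<union> G) \<inter> U = (F \<inter> U) \<union> (G \<inter> U)" by blast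
    moreover have "cl ((F \<inter> U) \<union> (G \<inter> U)) \<subseteq> cl (F \<union> G)" by (rule cl_mono) blast
    ultimately show ?thesis by auto
  qed
  have "equiv (carrier L) (kernel U)"
    unfolding kernel_def by (intro equivI refl_onI symI transI) auto
  moreover have "(x \<sqinter>\<^bsub>L\<^esub> y, x' \<sqinter>\<^bsub>L\<^esub> y') \<in> kernel U \<and> (x \<squnion>\<^bsub>L\<^esub> y, x' \<squnion>\<^bsub>L\<^esub> y') \<in> kernel U"
    if xy: "(x, x') \<in> kernel U" "(y, y') \<in> kernel U" for x x' y y'
  proof -
    have c: "x \<in> carrier L" "x' \<in> carrier L" "y \<in> carrier L" "y' \<in> carrier L"
      and x: "f x \<inter> U = f x' \<inter> U" and y: "f y \<inter> U = f y' \<inter> U"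
      using xy by (auto simp: kernel_def)
    have "f x \<inter> f y \<inter> U = f x' \<inter> f y' \<inter> U" using x y by blast
    moreover have "cl (f x \<union> f y) \<inter> U = cl (f x' \<union> f y') \<inter> U"
      using join_trace[OF f_mem[OF c(1)] f_mem[OF c(3)]] join_trace[OF f_mem[OF c(2)] f_mem[OF c(4)]] x y
      by simp
    ultimately show ?thesis using c by (simp add: kernel_def meet_rep join_rep)
  qed
  ultimately show ?thesis
    unfolding lattice_congruence_def by blast
qed

lemma down_minus_kernel_iff:
  assumes "q \<in> J" "x \<in> carrier L" "y \<in> carrier L" "f x = down q" "f y = down q - {q}"
  shows "(x, y) \<in> kernel U \<longleftrightarrow> q \<notin> U"
  using assms self_mem_down[of q] by (auto simp: kernel_def)

text \<open>A kernel remembers \<open>U\<close>: it identifies \<open>down q\<close> with its lower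
  cover exactly when \<open>q\<close> is missing from \<open>U\<close>.\<close>

lemma kernel_inj: "inj_on kernel {U. admissible U}"
proof (rule inj_onI)
  fix U V assume UV: "U \<in> {U. admissible U}" "V \<in> {U. admissible U}" "kernel U = kernel V"
  have "q \<in> U \<longleftrightarrow> q \<in> V" if q: "q \<in> J" for q
  proof -
    obtain x y where "x \<in> carrier L" "y \<in> carrier L" "f x = down q" "f y = down q - {q}"
      using f_surj down_mem[OF q] down_minus_mem[OF q] by metis
    then show ?thesis using down_minus_kernel_iff[OF q] UV(3) by metis
  qed
  then show "U = V" using UV(1,2) unfolding admissible_def by blast
qed

definition uncontracted :: "('b \<times> 'b) set \<Rightarrow> 'a set" where
  "uncontracted R =
     {q \<in> J. \<not> (\<exists>x y. (x, y) \<in> R \<and> f x = down q \<and> f y = down q - {q})}"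

text \<open>Congruent closed sets agree on \<open>U\<close>, since a disagreement would contract an
  element of \<open>U\<close>. Conversely, a closed set is congruent to the closure of its trace, so
  equal traces imply congruence. Admissibility compares the traces of \<open>cl X\<close> and
  \<open>cl (X \<inter> U)\<close>.\<close>

lemma congruence_kernel:
  assumes R: "lattice_congruence L R"
  defines "U \<equiv> uncontracted R"
  shows "admissible U" "R = kernel U"
proof -
  \<comment> \<open>Moves the congruence from \<open>L\<close> to the closed sets, where the
    operations are intersection and closure of the union.\<close>
  define rel where "rel F G \<longleftrightarrow> (\<exists>x y. (x, y) \<in> R \<and> f x = F \<and> f y = G)" for F G
  have eqv: "equiv (carrier L) R" using R by (simp add: lattice_congruence_def)
  have R_carrier: "x \<in> carrier L \<and> y \<in> carrier L" if "(x, y) \<in> R" for x y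
    using eqv that unfolding equiv_def by auto
  have rel_R: "(x, y) \<in> R" if "rel (f x) (f y)" "x \<in> carrier L" "y \<in> carrier L" for x y
    using that R_carrier f_eqD unfolding rel_def by metis
  have rel_mem: "F \<in> \<F> \<and> G \<in> \<F>" if "rel F G" for F G
    using that R_carrier f_mem unfolding rel_def by blast
  have rel_refl: "rel F F" if "F \<in> \<F>" for F
    using f_surj[OF that] eqv unfolding rel_def equiv_def refl_on_def by blast
  have rel_sym: "rel G F" if "rel F G" for F G
    using that eqv unfolding rel_def equiv_def sym_def by blast
  have rel_trans: "rel F H" if FG: "rel F G" and GH: "rel G H" for F G H
  proof -
    obtain x y where 1: "(x, y) \<in> R" "f x = F" "f y = G" using FG unfolding rel_def by blast
    obtain u z where 2: "(u, z) \<in> R" "f u = G" "f z = H" using GH unfolding rel_def by blast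
    have "u = y" using f_eqD 1 2 R_carrier by metis
    then have "(x, z) \<in> R" using eqv 1 2 unfolding equiv_def trans_def by blast
    then show ?thesis using 1 2 unfolding rel_def by blast
  qed
  have rel_inter: "rel (F \<inter> H) (G \<inter> K)" if FG: "rel F G" and HK: "rel H K" for F G H K
  proof -
    obtain x y where 1: "(x, y) \<in> R" "f x = F" "f y = G" using FG unfolding rel_def by blast
    obtain u z where 2: "(u, z) \<in> R" "f u = H" "f z = K" using HK unfolding rel_def by blast
    have "(x \<sqinter>\<^bsub>L\<^esub> u, y \<sqinter>\<^bsub>L\<^esub> z) \<in> R" using R 1 2 unfolding lattice_congruence_def by fast
    then show ?thesis using meet_rep 1 2 R_carrier unfolding rel_def by metis
  qed
  have rel_join: "rel (cl (F \<union> H)) (cl (G \<union> K))" if FG: "rel F G" and HK: "rel H K" for F G H K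
  proof -
    obtain x y where 1: "(x, y) \<in> R" "f x = F" "f y = G" using FG unfolding rel_def by blast
    obtain u z where 2: "(u, z) \<in> R" "f u = H" "f z = K" using HK unfolding rel_def by blast
    have "(x \<squnion>\<^bsub>L\<^esub> u, y \<squnion>\<^bsub>L\<^esub> z) \<in> R" using R 1 2 unfolding lattice_congruence_def by fast
    then show ?thesis using join_rep 1 2 R_carrier unfolding rel_def by metis
  qed
  have U_iff: "q \<in> U \<longleftrightarrow> q \<in> J \<and> \<not> rel (down q) (down q - {q})" for q
    unfolding U_def uncontracted_def rel_def by blast
  have U_J: "U \<subseteq> J" using U_iff by blast
  have same_trace: "p \<in> G" if FG: "rel F G" and p: "p \<in> F" "p \<in> U" for F G p
  proof (rule ccontr)
    assume pG: "p \<notin> G"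
    have mem: "F \<in> \<F>" "G \<in> \<F>" and pJ: "p \<in> J" using rel_mem[OF FG] p U_J by auto
    note dp = down_mem[OF pJ]
    \<comment> \<open>Meeting with \<open>down p\<close> and then joining with its lower cover turns
      the pair \<open>F\<close>, \<open>G\<close> into the pair \<open>down p\<close>,
      \<open>down p - {p}\<close>, which \<open>U\<close> forbids.\<close>
    have "rel (down p \<inter> F) (down p \<inter> G)" using rel_inter rel_refl dp FG by blast
    moreover have "down p \<inter> F = down p" using down_subset mem p by blast
    ultimately have 1: "rel (down p) (down p \<inter> G)" by simp
    have "rel (cl (down p \<union> (down p - {p}))) (cl (down p \<inter> G \<union> (down p - {p})))"
      using rel_join 1 rel_refl[OF down_minus_mem[OF pJ]] by blast
    moreover have "down p \<union> (down p - {p}) = down p" by blast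
    moreover have "down p \<inter> G \<union> (down p - {p}) = down p - {p}" using pG by blast
    ultimately have "rel (down p) (down p - {p})"
      using cl_id down_minus_mem[OF pJ] dp by simp
    then show False using p U_iff by blast
  qed
  \<comment> \<open>Elements outside \<open>U\<close> can be adjoined one at a time, smallest first, without leaving the class.\<close>
  have rel_cl: "rel (cl (X \<inter> U)) (cl X)" if X: "down_closed X" for X
  proof -
    have XJ: "X \<subseteq> J" using X by (simp add: down_closed_def)
    define \<K> where "\<K> = {K. rel (cl (X \<inter> U)) K \<and> K \<subseteq> cl X}"
    have sub: "\<K> \<subseteq> Pow J" using rel_mem subset_J unfolding \<K>_def by blast
    then have fin: "finite \<K>" using finite_J by (meson finite_Pow_iff finite_subset)
    have cU: "cl (X \<inter> U) \<in> \<F>" using cl_mem XJ by blast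
    have "cl (X \<inter> U) \<in> \<K>" unfolding \<K>_def using rel_refl[OF cU] cl_mono[of "X \<inter> U" X] by blast
    then obtain K where K: "K \<in> \<K>" and K_sup: "cl (X \<inter> U) \<subseteq> K"
      and K_max: "\<And>K'. K' \<in> \<K> \<Longrightarrow> K \<subseteq> K' \<Longrightarrow> K = K'"
      using finite_has_maximal2[OF fin] by metis
    have K_rel: "rel (cl (X \<inter> U)) K" "K \<subseteq> cl X" using K unfolding \<K>_def by auto
    have K_mem: "K \<in> \<F>" using rel_mem[OF K_rel(1)] by blast
    have "X \<subseteq> K"
    proof (rule ccontr)
      assume "\<not> X \<subseteq> K"
      then obtain q0 where "q0 \<in> X - K" by blast
      then obtain q where q: "q \<in> X - K"
        and q_min: "\<And>r. r \<in> X - K \<Longrightarrow> card (down q) \<le> card (down r)"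
        using ex_has_least_nat[of "\<lambda>q. q \<in> X - K" q0 "\<lambda>q. card (down q)"] by blast
      have qJ: "q \<in> J" using q XJ by blast
      have below: "down q - {q} \<subseteq> K"
      proof
        fix r assume r: "r \<in> down q - {q}"
        then have "r \<in> X" using q X unfolding down_closed_def by blast
        have "down r \<subseteq> down q - {q}" using down_subset down_minus_mem[OF qJ] r by blast
        then have "down r \<subset> down q" using self_mem_down[OF qJ] by blast
        moreover have "finite (down q)"
          using subset_J[OF down_mem[OF qJ]] finite_J by (rule finite_subset)
        ultimately have "card (down r) < card (down q)" by (rule psubset_card_mono[rotated])
        then show "r \<in> K" using q_min[of r] \<open>r \<in> X\<close> by auto
      qed
      have "q \<notin> U" using q K_sup cl_upper[of "X \<inter> U"] by blast
      then have "rel (down q - {q}) (down q)" using U_iff qJ rel_sym by blast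
      then have "rel (cl (K \<union> (down q - {q}))) (cl (K \<union> down q))"
        using rel_join rel_refl[OF K_mem] by blast
      moreover have "K \<union> (down q - {q}) = K" using below by blast
      ultimately have "rel K (cl (K \<union> down q))" using cl_id K_mem by simp
      then have "rel (cl (X \<inter> U)) (cl (K \<union> down q))" using rel_trans K_rel(1) by blast
      moreover have "cl (K \<union> down q) \<subseteq> cl X"
      proof (rule cl_least)
        show "cl X \<in> \<F>" using cl_mem XJ by blast
        show "K \<union> down q \<subseteq> cl X"
          using K_rel(2) q X cl_upper[of X] unfolding down_closed_def by blast
      qed
      ultimately have "cl (K \<union> down q) \<in> \<K>" unfolding \<K>_def by blast
      moreover have "K \<subseteq> cl (K \<union> down q)" "q \<in> cl (K \<union> down q)"
        using cl_upper[of "K \<union> down q"] self_mem_down[OF qJ] by auto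
      ultimately show False using K_max q by blast
    qed
    then have "cl X \<subseteq> K" using cl_least K_mem by blast
    then show ?thesis using K_rel by auto
  qed
  show adm: "admissible U"
    unfolding admissible_def
  proof (intro conjI allI impI)
    show "cl X \<inter> U \<subseteq> cl (X \<inter> U)" if "down_closed X" for X
      using same_trace[OF rel_sym[OF rel_cl[OF that]]] by blast
  qed (rule U_J)
  show "R = kernel U"
  proof (intro subset_antisym subrelI)
    fix x y assume xy: "(x, y) \<in> R"
    then have rel: "rel (f x) (f y)" unfolding rel_def by blast
    then have "f x \<inter> U = f y \<inter> U" using same_trace rel_sym by blast
    then show "(x, y) \<in> kernel U" using R_carrier[OF xy] by (simp add: kernel_def)
  next
    fix x y assume "(x, y) \<in> kernel U"
    then have xy: "x \<in> carrier L" "y \<in> carrier L" "f x \<inter> U = f y \<inter> U"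
      by (auto simp: kernel_def)
    have "rel (cl (f z \<inter> U)) (f z)" if "z \<in> carrier L" for z
      using rel_cl[of "f z"] down_closed_Un_closed[of "f z" "f z"] f_mem[OF that] cl_id by simp
    then have "rel (f x) (f y)" using xy rel_sym rel_trans by metis
    then show "(x, y) \<in> R" using rel_R xy by blast
  qed
qed

theorem card_congruences:
  "card (carrier (congruence_lattice L)) = card {U. admissible U}"
proof -
  have "bij_betw kernel {U. admissible U} {R. lattice_congruence L R}"
  proof (rule bij_betw_imageI[OF kernel_inj subset_antisym])
    show "kernel ` {U. admissible U} \<subseteq> {R. lattice_congruence L R}"
      using kernel_congruence by auto
    show "{R. lattice_congruence L R} \<subseteq> kernel ` {U. admissible U}"
      using congruence_kernel by auto
  qed
  then show ?thesis
    by (simp add: congruence_lattice_def bij_betw_same_card)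
qed

end

section \<open>Fb-tableaux as closed sets\<close>

text \<open>
  At a cell of \<open>core n\<close>, \<open>Beta\<close> says that there is an up-arrow strictly above, \<open>Gamma\<close> that moreover
  there is no left-arrow strictly to the left, and \<open>Delta\<close> lies between the two: if the
  cell is free, it contains a dot. At border cells \<open>Delta\<close> would coincide with \<open>Beta\<close> and is omitted.
\<close>

datatype kind = Beta | Delta | Gamma

definition core :: "nat \<Rightarrow> cell set" where
  "core n = {(i, j). 2 \<le> i \<and> i \<le> j + 1 \<and> j < n}"

definition atoms :: "nat \<Rightarrow> (kind \<times> cell) set" where
  "atoms n = {(x, i, j). (i, j) \<in> core n \<and> (x = Delta \<longrightarrow> i \<le> j)}"

text \<open>The implications that hold within a column. A nonempty cell above a cell is also above
  all cells further down, so \<open>Beta\<close> descends; \<open>Delta\<close> and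
  \<open>Gamma\<close> also speak about the row and stay in it.\<close>

definition below :: "nat \<Rightarrow> kind \<times> cell \<Rightarrow> (kind \<times> cell) set" where
  "below n = (\<lambda>(x, i, j).
     {(y, k, l) \<in> atoms n. l = j \<and> (y = Beta \<and> i \<le> k \<or> k = i \<and> (y = x \<or> x = Gamma))})"

text \<open>In the last clause \<open>j\<close> lies to the left of \<open>j'\<close>. By
  \<open>(Gamma, i, j')\<close> row \<open>i\<close> is empty there, so the nonempty cell witnessing
  \<open>(Beta, i + 1, j)\<close> is not in row \<open>i\<close> and must be above it.\<close>

definition closed_set :: "nat \<Rightarrow> (kind \<times> cell) set \<Rightarrow> bool" where
  "closed_set n F \<longleftrightarrow>
     F \<subseteq> atoms n \<and> (\<forall>q \<in> F. below n q \<subseteq> F) \<and>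
     (\<forall>i j j'. (Gamma, i, j') \<in> F \<and> j' < j \<and> (Beta, i + 1, j) \<in> F \<longrightarrow> (Gamma, i, j) \<in> F)"

definition encode :: "nat \<Rightarrow> cell set \<Rightarrow> (kind \<times> cell) set" where
  "encode n T = {(x, c) \<in> atoms n. has_above T c \<and>
     (x = Delta \<longrightarrow> has_left T c \<longrightarrow> c \<in> T) \<and> (x = Gamma \<longrightarrow> \<not> has_left T c)}"

text \<open>The three alternatives in the core are up-arrows, left-arrows and dots. An up-arrow sits
  just above the topmost \<open>Beta\<close> of its column, or at the border if the column has no
  \<open>Beta\<close>. The left-arrow of a row is its rightmost \<open>Gamma\<close>, the one with
  least label, or lies in column \<open>n\<close> if the row has no \<open>Gamma\<close>. Border
  cells have no \<open>Delta\<close>, so their dots are read off from \<open>Beta\<close>.\<close>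

definition decode :: "nat \<Rightarrow> (kind \<times> cell) set \<Rightarrow> cell set" where
  "decode n F =
     {(1, n)} \<union> {(1, j) | j. (Beta, 2, j) \<in> F} \<union>
     {(i, n) | i. 2 \<le> i \<and> i \<le> n \<and> (\<forall>j. (Gamma, i, j) \<notin> F)} \<union>
     {(i, j) \<in> core n.
        (Beta, i, j) \<notin> F \<and> (i = j + 1 \<or> (Beta, i + 1, j) \<in> F) \<or>
        (Gamma, i, j) \<in> F \<and> (\<forall>k < j. (Gamma, i, k) \<notin> F) \<or>
        ((Delta, i, j) \<in> F \<or> i = j + 1 \<and> (Beta, i, j) \<in> F) \<and> (Gamma, i, j) \<notin> F}"

lemma core_iff [simp]: "(i, j) \<in> core n \<longleftrightarrow> 2 \<le> i \<and> i \<le> j + 1 \<and> j < n"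
  by (simp add: core_def)

lemma atoms_iff [simp]:
  "(x, i, j) \<in> atoms n \<longleftrightarrow> 2 \<le> i \<and> i \<le> j + 1 \<and> j < n \<and> (x = Delta \<longrightarrow> i \<le> j)"
  by (auto simp: atoms_def)

lemma below_iff [simp]:
  "(y, k, l) \<in> below n (x, i, j) \<longleftrightarrow>
     (y, k, l) \<in> atoms n \<and> l = j \<and> (y = Beta \<and> i \<le> k \<or> k = i \<and> (y = x \<or> x = Gamma))"
  by (auto simp: below_def)

lemma board_iff [simp]:
  "(i, j) \<in> board n \<longleftrightarrow> i = 1 \<and> 1 \<le> j \<and> j \<le> n \<or> 2 \<le> i \<and> i \<le> j + 1 \<and> i \<le> n \<and> j \<le> n"
  by (auto simp: board_def)

lemma encode_iff:
  "(x, i, j) \<in> encode n T \<longleftrightarrow> (x, i, j) \<in> atoms n \<and> has_above T (i, j) \<and>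
     (x = Delta \<longrightarrow> has_left T (i, j) \<longrightarrow> (i, j) \<in> T) \<and> (x = Gamma \<longrightarrow> \<not> has_left T (i, j))"
  by (auto simp: encode_def)

lemma has_left_iff [simp]: "has_left T (i, j) \<longleftrightarrow> (\<exists>k > j. (i, k) \<in> T)"
  by (simp add: has_left_def)

lemma has_above_iff [simp]: "has_above T (i, j) \<longleftrightarrow> (\<exists>k < i. (k, j) \<in> T)"
  by (simp add: has_above_def)

lemma finite_atoms: "finite (atoms n)"
proof (rule finite_subset)
  show "atoms n \<subseteq> {Beta, Delta, Gamma} \<times> {..n} \<times> {..n}"
    using kind.nchotomy by (auto simp: atoms_def)
qed simp

context
  fixes n F
  assumes closed: "closed_set n F"
begin

lemma closed_set_atoms: "(x, i, j) \<in> F \<Longrightarrow> 2 \<le> i \<and> i \<le> j + 1 \<and> j < n \<and> (x = Delta \<longrightarrow> i \<le> j)"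
  using closed unfolding closed_set_def by fastforce

lemma closed_set_below: "(x, i, j) \<in> F \<Longrightarrow> q \<in> below n (x, i, j) \<Longrightarrow> q \<in> F"
  using closed unfolding closed_set_def by blast

lemma closed_set_Beta: "(x, i, j) \<in> F \<Longrightarrow> i \<le> k \<Longrightarrow> k \<le> j + 1 \<Longrightarrow> (Beta, k, j) \<in> F"
  using closed_set_below[of x i j "(Beta, k, j)"] closed_set_atoms[of x i j] by simp

lemma closed_set_Delta: "(Gamma, i, j) \<in> F \<Longrightarrow> i \<le> j \<Longrightarrow> (Delta, i, j) \<in> F"
  using closed_set_below[of Gamma i j "(Delta, i, j)"] closed_set_atoms[of Gamma i j] by simp

text \<open>Any element of column \<open>j\<close> in row \<open>i + 1\<close> or higher up has
  \<open>(Beta, i + 1, j)\<close> below it.\<close>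

lemma closed_set_Gamma:
  assumes "(Gamma, i, j') \<in> F" "j' < j" "(x, k, j) \<in> F" "k \<le> i + 1"
  shows "(Gamma, i, j) \<in> F"
proof -
  have "(Beta, i + 1, j) \<in> F"
    using closed_set_Beta[of x k j "i + 1"] assms closed_set_atoms[of Gamma i j'] by simp
  then show ?thesis using closed assms unfolding closed_set_def by blast
qed

section \<open>Decoding and encoding are mutually inverse\<close>

lemma has_above_decode:
  assumes ij: "(i, j) \<in> core n"
  shows "has_above (decode n F) (i, j) \<longleftrightarrow> (Beta, i, j) \<in> F"
proof
  assume "has_above (decode n F) (i, j)"
  then obtain k where k: "k < i" "(k, j) \<in> decode n F" by auto
  have "k \<le> j" using k(1) ij by simp
  then have "(Beta, 2, j) \<in> F \<or> (Beta, k + 1, j) \<in> F \<or> (\<exists>x. (x, k, j) \<in> F)"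
    using k ij unfolding decode_def by auto
  then show "(Beta, i, j) \<in> F"
    using closed_set_Beta[of _ _ j i] ij k by (metis Suc_eq_plus1 Suc_leI core_iff less_imp_le)
next
  assume B: "(Beta, i, j) \<in> F"
  \<comment> \<open>The topmost \<open>Beta\<close> of the column. The cell directly above it is
    decoded as nonempty: in the first row if \<open>k = 2\<close>, as an up-arrow of the core
    otherwise.\<close>
  define k where "k = (LEAST k. (Beta, k, j) \<in> F)"
  have k: "(Beta, k, j) \<in> F" "k \<le> i"
    unfolding k_def using LeastI[of "\<lambda>k. (Beta, k, j) \<in> F", OF B] Least_le[of "\<lambda>k. (Beta, k, j) \<in> F", OF B] by auto
  have k2: "2 \<le> k" using closed_set_atoms k by blast
  have "(k - 1, j) \<in> decode n F"
  proof (cases "k = 2")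
    case True
    then show ?thesis using k unfolding decode_def by auto
  next
    case False
    have "(Beta, k - 1, j) \<notin> F" using not_less_Least[of "k - 1" "\<lambda>k. (Beta, k, j) \<in> F"] k2 k_def by auto
    moreover have "2 \<le> k - 1" "k - 1 + 1 = k" "k - 1 \<le> j + 1" using False k k2 ij by auto
    ultimately show ?thesis using k ij unfolding decode_def by simp
  qed
  then show "has_above (decode n F) (i, j)" using k k2 by (auto intro!: exI[of _ "k - 1"])
qed

lemma has_left_decode:
  assumes ij: "(i, j) \<in> core n"
  shows "has_left (decode n F) (i, j) \<longleftrightarrow> (\<forall>j' \<le> j. (Gamma, i, j') \<notin> F)"
proof
  assume "has_left (decode n F) (i, j)"
  then obtain k where k: "j < k" "(i, k) \<in> decode n F" by auto
  show "\<forall>j' \<le> j. (Gamma, i, j') \<notin> F"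
  proof (intro allI impI notI)
    fix j' assume j': "j' \<le> j" "(Gamma, i, j') \<in> F"
    \<comment> \<open>With \<open>(Gamma, i, j')\<close> to its right, a core cell
      \<open>(i, k)\<close> that is nonempty as an up-arrow or a dot would carry
      \<open>Gamma\<close>, contrary to its type; as a left-arrow it would not be the rightmost
      \<open>Gamma\<close>.\<close>
    have not_above: "(Beta, i, k) \<in> F \<or> (Beta, i + 1, k) \<in> F \<Longrightarrow> (Gamma, i, k) \<in> F"
      using closed_set_Gamma[OF j'(2)] j' k by auto
    have Beta: "(x, i, k) \<in> F \<Longrightarrow> (Beta, i, k) \<in> F" for x
      using closed_set_Beta[of x i k i] closed_set_atoms[of x i k] by auto
    show False using k ij j' not_above Beta unfolding decode_def by auto
  qed
next
  assume none: "\<forall>j' \<le> j. (Gamma, i, j') \<notin> F"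
  show "has_left (decode n F) (i, j)"
  proof (cases "\<exists>l. (Gamma, i, l) \<in> F")
    case False
    then have "(i, n) \<in> decode n F" using ij unfolding decode_def by auto
    then show ?thesis using ij by auto
  next
    case True
    define l where "l = (LEAST l. (Gamma, i, l) \<in> F)"
    have l: "(Gamma, i, l) \<in> F" "\<forall>k<l. (Gamma, i, k) \<notin> F"
      unfolding l_def using LeastI_ex[OF True] not_less_Least by auto
    then have "(i, l) \<in> decode n F" using closed_set_atoms[OF l(1)] unfolding decode_def by auto
    moreover have "j < l" using none l(1) not_le by blast
    ultimately show ?thesis by auto
  qed
qed

lemma decode_core_iff:
  assumes "(i, j) \<in> core n"
  shows "(i, j) \<in> decode n F \<longleftrightarrow>
    (Beta, i, j) \<notin> F \<and> (i = j + 1 \<or> (Beta, i + 1, j) \<in> F) \<or>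
    (Gamma, i, j) \<in> F \<and> (\<forall>k < j. (Gamma, i, k) \<notin> F) \<or>
    ((Delta, i, j) \<in> F \<or> i = j + 1 \<and> (Beta, i, j) \<in> F) \<and> (Gamma, i, j) \<notin> F"
  using assms unfolding decode_def by auto

lemma encode_decode: "encode n (decode n F) = F"
proof -
  have "(x, i, j) \<in> encode n (decode n F) \<longleftrightarrow> (x, i, j) \<in> F" for x i j
  proof (cases "(i, j) \<in> core n")
    case False
    then show ?thesis using closed_set_atoms[of x i j] by (auto simp: encode_iff)
  next
    case True
    have Beta: "(y, i, j) \<in> F \<Longrightarrow> (Beta, i, j) \<in> F" for y
      using closed_set_Beta[of y i j i] True by auto
    have Gamma: "(Beta, i, j) \<in> F \<Longrightarrow> k \<le> j \<Longrightarrow> (Gamma, i, k) \<in> F \<Longrightarrow> (Gamma, i, j) \<in> F" for k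
      using closed_set_Gamma[of i k j Beta i] by (cases "k = j") auto
    show ?thesis
      using True Beta Gamma closed_set_Delta[of i j] closed_set_atoms[of Delta i j]
      unfolding encode_iff has_above_decode[OF True] has_left_decode[OF True] decode_core_iff[OF True]
      by (cases x) auto
  qed
  then show ?thesis by auto
qed

lemma fb_tableau_decode:
  assumes "n \<ge> 1"
  shows "fb_tableau n (decode n F)"
proof -
  have "decode n F \<subseteq> board n"
    using assms closed_set_atoms[of Beta 2] unfolding decode_def by fastforce
  moreover have "root n \<in> decode n F" unfolding root_def decode_def by simp
  moreover have "(i, i - 1) \<in> decode n F" if i: "2 \<le> i" "i \<le> n" for i
  proof -
    \<comment> \<open>With no \<open>Gamma\<close> to its right, a border cell is nonempty in every
      case: a left-arrow if it carries \<open>Gamma\<close>, a dot if it carries only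
      \<open>Beta\<close>, an up-arrow if it carries nothing.\<close>
    have "(Gamma, i, k) \<notin> F" if "k < i - 1" for k
      using closed_set_atoms[of Gamma i k] that by auto
    then show ?thesis using i by (subst decode_core_iff) auto
  qed
  then have "border n \<subseteq> decode n F" unfolding border_def by auto
  moreover have "has_left (decode n F) (i, j) \<or> has_above (decode n F) (i, j)"
    if T: "(i, j) \<in> decode n F" and nr: "(i, j) \<noteq> (1, n)" for i j
  proof (cases "(i, j) \<in> core n")
    case True
    show ?thesis
    proof (cases "(Beta, i, j) \<in> F")
      case True
      then show ?thesis using has_above_decode[OF \<open>(i, j) \<in> core n\<close>] by blast
    next
      case False
      have nF: "(x, i, j) \<notin> F" for x
        using False closed_set_Beta[of x i j i] True by auto
      then have "i = j + 1 \<or> (Beta, i + 1, j) \<in> F" using T decode_core_iff[OF True] by auto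
      \<comment> \<open>The cell is an up-arrow, so something must be to its left. A
        \<open>Gamma\<close> in this row weakly to the right would spread to \<open>(i, j)\<close>
        by the two-premise rule, but \<open>(i, j)\<close> carries no element of
        \<open>F\<close>.\<close>
      then have "(Gamma, i, k) \<notin> F" if "k \<le> j" for k
        using that nF closed_set_Gamma[of i k j Beta "i + 1"] closed_set_atoms[of Gamma i k]
        by (cases "k = j") auto
      then show ?thesis using has_left_decode[OF True] by blast
    qed
  next
    case False
    then consider "i = 1" "j < n" | "j = n" "2 \<le> i"
      using T nr closed_set_atoms[of Beta 2 j] unfolding decode_def by auto
    then show ?thesis
    proof cases
      case 1
      then have "(1, n) \<in> decode n F" "n > j" unfolding decode_def by auto
      then show ?thesis using 1 by auto
    next
      case 2
      then have "(1, n) \<in> decode n F" "1 < i" unfolding decode_def by auto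
      then show ?thesis using 2 by auto
    qed
  qed
  ultimately show ?thesis unfolding fb_tableau_def root_def by (auto simp del: has_left_iff has_above_iff)
qed

end

lemma closed_set_encode:
  assumes T: "fb_tableau n T"
  shows "closed_set n (encode n T)"
proof -
  have "below n (x, i, j) \<subseteq> encode n T" if "(x, i, j) \<in> encode n T" for x i j
  proof
    fix q assume q: "q \<in> below n (x, i, j)"
    obtain y k l where [simp]: "q = (y, k, l)" using prod_cases3 by blast
    show "q \<in> encode n T"
      using q that by (cases x; cases y) (auto simp: encode_iff intro: less_le_trans)
  qed
  moreover have "(Gamma, i, j) \<in> encode n T"
    if G: "(Gamma, i, j') \<in> encode n T" "j' < j" and B: "(Beta, i + 1, j) \<in> encode n T" for i j j'
  proof -
    have no_left: "(i, k) \<notin> T" if "j \<le> k" for k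
      using G that by (auto simp: encode_iff)
    obtain k where "k < i + 1" "(k, j) \<in> T"
      using B by (auto simp: encode_iff)
    then have "k < i" "(k, j) \<in> T" using no_left[of j] less_antisym by fastforce+
    then show ?thesis using G B no_left by (auto simp: encode_iff)
  qed
  moreover have "encode n T \<subseteq> atoms n" unfolding encode_def by blast
  ultimately show ?thesis unfolding closed_set_def by auto
qed

context
  fixes n T
  assumes T: "fb_tableau n T"
begin

lemma tableau_board: "(i, j) \<in> T \<Longrightarrow> (i, j) \<in> board n"
  using T unfolding fb_tableau_def by blast

lemma tableau_root: "(1, n) \<in> T"
  using T unfolding fb_tableau_def root_def by blast

lemma tableau_border: "2 \<le> i \<Longrightarrow> i \<le> n \<Longrightarrow> (i, i - 1) \<in> T"
  using T unfolding fb_tableau_def border_def by blast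

lemma tableau_has_left_or_above:
  "(i, j) \<in> T \<Longrightarrow> (i, j) \<noteq> (1, n) \<Longrightarrow> has_left T (i, j) \<or> has_above T (i, j)"
  using T unfolding fb_tableau_def root_def by blast

lemma row_leftmost:
  assumes i: "(i, j) \<in> T"
  obtains k where "j \<le> k" "(i, k) \<in> T" "\<not> has_left T (i, k)"
proof -
  have fin: "finite {k. (i, k) \<in> T}"
    by (rule finite_subset[of _ "{..n}"]) (use tableau_board in auto)
  define k where "k = Max {k. (i, k) \<in> T}"
  have "(i, k) \<in> T" using Max_in[OF fin] i unfolding k_def by auto
  moreover have "l \<le> k" if "(i, l) \<in> T" for l
    using Max_ge[OF fin] that unfolding k_def by auto
  ultimately show thesis using that[of k] i by (simp add: leD) (meson leD)
qed

lemma column_top: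
  assumes i: "(i, j) \<in> T"
  obtains k where "k \<le> i" "(k, j) \<in> T" "\<not> has_above T (k, j)"
proof -
  define k where "k = (LEAST k. (k, j) \<in> T)"
  have "k \<le> i" "(k, j) \<in> T" "\<not> has_above T (k, j)"
    unfolding k_def using LeastI[of "\<lambda>k. (k, j) \<in> T", OF i] Least_le[of "\<lambda>k. (k, j) \<in> T", OF i]
      not_less_Least by auto
  then show thesis by (rule that)
qed

text \<open>Row \<open>i\<close> is nonempty because of its border cell. Its leftmost nonempty cell
  has nothing to its left, so the tableau condition supplies a nonempty cell above it.\<close>

lemma Gamma_leftmost:
  assumes "(i, j) \<in> core n"
  obtains k where "(i, k) \<in> T" "\<not> has_left T (i, k)" "k < n \<Longrightarrow> (Gamma, i, k) \<in> encode n T"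
proof -
  obtain k where k: "(i, k) \<in> T" "\<not> has_left T (i, k)"
    using row_leftmost[OF tableau_border[of i]] assms by auto
  moreover have "(Gamma, i, k) \<in> encode n T" if "k < n"
    using k that tableau_has_left_or_above[OF k(1)] tableau_board[OF k(1)] assms
    by (auto simp: encode_iff)
  ultimately show thesis using that by blast
qed

lemma decode_encode: "decode n (encode n T) = T"
proof -
  let ?F = "encode n T"
  have closed: "closed_set n ?F" using T by (rule closed_set_encode)
  have core: "(i, j) \<in> decode n ?F \<longleftrightarrow> (i, j) \<in> T" if ij: "(i, j) \<in> core n" for i j
  proof -
    have no_left: "has_left T (i, j) \<longleftrightarrow> (\<forall>k \<le> j. (Gamma, i, k) \<notin> ?F)"
    proof
      assume "\<forall>k \<le> j. (Gamma, i, k) \<notin> ?F"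
      moreover obtain k where k: "(i, k) \<in> T" "k < n \<Longrightarrow> (Gamma, i, k) \<in> ?F"
        using Gamma_leftmost[OF ij] by metis
      ultimately have "j < k" using ij by (meson core_iff not_le le_less_trans)
      then show "has_left T (i, j)" using k by auto
    qed (auto simp: encode_iff intro: less_trans le_less_trans)
    have above: "has_above T (i, j) \<longleftrightarrow> (Beta, i, j) \<in> ?F"
      using ij by (simp add: encode_iff)
    have border: "(i, j) \<in> T" if "i = j + 1"
      using tableau_border[of i] ij that by simp
    \<comment> \<open>The witness for \<open>(Beta, i + 1, j)\<close> lies in row \<open>i\<close>
      or above; if nothing is above row \<open>i\<close>, it is the cell itself.\<close>
    have next_row: "(i, j) \<in> T" if "(Beta, i + 1, j) \<in> ?F" "\<not> has_above T (i, j)"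
      using that by (auto simp: encode_iff less_Suc_eq)
    have next_row': "(Beta, i + 1, j) \<in> ?F" if "(i, j) \<in> T" "i \<noteq> j + 1"
      using that ij by (auto simp: encode_iff)
    show ?thesis
    proof (cases "has_above T (i, j)")
      case False
      then have "(x, i, j) \<notin> ?F" for x by (simp add: encode_iff del: has_above_iff)
      then show ?thesis
        unfolding decode_core_iff[OF closed ij] using False border next_row next_row' by blast
    next
      case above': True
      show ?thesis
      proof (cases "has_left T (i, j)")
        case True
        then have "(Gamma, i, j) \<notin> ?F" using no_left by blast
        moreover have "(Delta, i, j) \<in> ?F \<longleftrightarrow> i \<noteq> j + 1 \<and> (i, j) \<in> T"
          using True above' ij by (auto simp: encode_iff simp del: has_above_iff has_left_iff)
        ultimately show ?thesis
          unfolding decode_core_iff[OF closed ij] using above above' border by blast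
      next
        case False
        then have G: "(Gamma, i, j) \<in> ?F"
          using above' ij by (auto simp: encode_iff simp del: has_above_iff has_left_iff)
        have "(i, j) \<in> T \<longleftrightarrow> (\<forall>k < j. (Gamma, i, k) \<notin> ?F)"
        proof
          assume "(i, j) \<in> T"
          then show "\<forall>k < j. (Gamma, i, k) \<notin> ?F" by (auto simp: encode_iff)
        next
          assume none: "\<forall>k < j. (Gamma, i, k) \<notin> ?F"
          obtain k where k: "(i, k) \<in> T" "k < n \<Longrightarrow> (Gamma, i, k) \<in> ?F"
            using Gamma_leftmost[OF ij] by metis
          have "k \<le> j" using False k(1) by (simp add: not_le[symmetric]) (meson not_le)
          then have "k = j" using none k(2) ij by (metis core_iff le_less_trans le_neq_implies_less)
          then show "(i, j) \<in> T" using k by blast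
        qed
        then show ?thesis
          unfolding decode_core_iff[OF closed ij] using G above above' by blast
      qed
    qed
  qed
  have row1: "(1, j) \<in> decode n ?F \<longleftrightarrow> (1, j) \<in> T" for j
  proof -
    have "(Beta, 2, j) \<in> ?F \<longleftrightarrow> (1, j) \<in> T" if "j < n"
    proof -
      have "has_above T (2, j) \<longleftrightarrow> (1, j) \<in> T"
      proof
        assume "has_above T (2, j)"
        then obtain k where "k < 2" "(k, j) \<in> T" by auto
        moreover from this have "k = 1" using tableau_board[of k j] by auto
        ultimately show "(1, j) \<in> T" by simp
      qed (auto intro!: exI[of _ 1])
      moreover have "1 \<le> j" if "(1, j) \<in> T" using tableau_board[OF that] by auto
      ultimately show ?thesis
        using that unfolding encode_iff by (auto simp del: has_above_iff)
    qed
    moreover have "j < n" if "(Beta, 2, j) \<in> ?F" using that by (simp add: encode_iff)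
    moreover have "j < n \<or> j = n" if "(1, j) \<in> T" using tableau_board[OF that] by auto
    ultimately show ?thesis using tableau_root unfolding decode_def by auto
  qed
  have coln: "(i, n) \<in> decode n ?F \<longleftrightarrow> (i, n) \<in> T" if i: "2 \<le> i" "i \<le> n" for i
  proof -
    have "(i, n) \<in> T \<longleftrightarrow> (\<forall>j. (Gamma, i, j) \<notin> ?F)"
    proof
      assume none: "\<forall>j. (Gamma, i, j) \<notin> ?F"
      have "(i, i - 1) \<in> core n" using i by auto
      then obtain k where k: "(i, k) \<in> T" "k < n \<Longrightarrow> (Gamma, i, k) \<in> ?F"
        using Gamma_leftmost by metis
      then have "k = n" using none tableau_board[OF k(1)] i by fastforce
      then show "(i, n) \<in> T" using k by blast
    qed (auto simp: encode_iff)
    then show ?thesis using i unfolding decode_def by auto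
  qed
  have "1 \<le> n" using tableau_board[OF tableau_root] by auto
  then have "decode n ?F \<subseteq> board n"
    using fb_tableau_decode[OF closed] unfolding fb_tableau_def by blast
  moreover have "(i, j) \<in> decode n ?F \<longleftrightarrow> (i, j) \<in> T" if "(i, j) \<in> board n" for i j
  proof -
    consider "i = 1" | "(i, j) \<in> core n" | "j = n" "2 \<le> i" "i \<le> n" using \<open>(i, j) \<in> board n\<close> by fastforce
    then show ?thesis using core row1 coln by cases blast+
  qed
  ultimately show ?thesis using tableau_board by (auto simp del: board_iff)
qed

section \<open>The order of tableaux as inclusion of their codes\<close>

lemma Col_iff: "(i, j) \<in> Col n T \<longleftrightarrow> (i, j) \<in> board n \<and> (\<exists>k \<le> i. (k, j) \<in> T)"
proof -
  have "(\<exists>k \<le> i. up_arrow n T (k, j) \<or> (k, j) = root n) \<longleftrightarrow> (\<exists>k \<le> i. (k, j) \<in> T)"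
  proof
    assume "\<exists>k \<le> i. (k, j) \<in> T"
    then obtain k0 where "k0 \<le> i" "(k0, j) \<in> T" by blast
    then obtain k where "k \<le> i" "(k, j) \<in> T" "\<not> has_above T (k, j)"
      using column_top by (metis order_trans)
    then show "\<exists>k \<le> i. up_arrow n T (k, j) \<or> (k, j) = root n"
      unfolding up_arrow_def by blast
  qed (use tableau_root in \<open>auto simp: up_arrow_def root_def\<close>)
  then show ?thesis unfolding Col_def by blast
qed

lemma Row_iff: "(i, j) \<in> Row n T \<longleftrightarrow> (i, j) \<in> board n \<and> (\<exists>k \<ge> j. (i, k) \<in> T)"
proof -
  have "(\<exists>k \<ge> j. left_arrow n T (i, k) \<or> (i, k) = root n) \<longleftrightarrow> (\<exists>k \<ge> j. (i, k) \<in> T)"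
  proof
    assume "\<exists>k \<ge> j. (i, k) \<in> T"
    then obtain k0 where "k0 \<ge> j" "(i, k0) \<in> T" by blast
    then obtain k where "k \<ge> j" "(i, k) \<in> T" "\<not> has_left T (i, k)"
      using row_leftmost by (metis order_trans)
    then show "\<exists>k \<ge> j. left_arrow n T (i, k) \<or> (i, k) = root n"
      unfolding left_arrow_def by blast
  qed (use tableau_root in \<open>auto simp: left_arrow_def root_def\<close>)
  then show ?thesis unfolding Row_def by blast
qed

lemma free_cell_iff:
  "free_cell n T (i, j) \<longleftrightarrow> (i, j) \<in> core n \<and> has_above T (i, j) \<and> has_left T (i, j)"
proof
  assume "free_cell n T (i, j)"
  then obtain k l where kl: "(i, j) \<in> board n" "k < i" "(k, j) \<in> T" "j < l" "(i, l) \<in> T"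
    unfolding free_cell_def up_arrow_def left_arrow_def by auto
  then show "(i, j) \<in> core n \<and> has_above T (i, j) \<and> has_left T (i, j)"
    using tableau_board[of k j] tableau_board[of i l] by auto
next
  assume *: "(i, j) \<in> core n \<and> has_above T (i, j) \<and> has_left T (i, j)"
  then obtain k0 l0 where 0: "k0 < i" "(k0, j) \<in> T" "j < l0" "(i, l0) \<in> T" by auto
  obtain k where "k < i" "(k, j) \<in> T" "\<not> has_above T (k, j)"
    using column_top[OF 0(2)] 0(1) le_less_trans by metis
  moreover obtain l where "j < l" "(i, l) \<in> T" "\<not> has_left T (i, l)"
    using row_leftmost[OF 0(4)] 0(3) less_le_trans by metis
  ultimately show "free_cell n T (i, j)"
    using * unfolding free_cell_def up_arrow_def left_arrow_def root_def
    by (auto simp del: has_above_iff has_left_iff)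
qed

lemma is_dot_iff:
  "free_cell n T c \<Longrightarrow> is_dot n T c \<longleftrightarrow> c \<in> T"
  by (cases c) (simp add: free_cell_iff is_dot_def left_arrow_def up_arrow_def)

end

text \<open>Membership of a cell in \<open>Col\<close> is \<open>has_above\<close> one row further
  down, and membership in \<open>Row\<close> is \<open>has_left\<close> one column further right.
  Where this shift leaves the core, the cell belongs to \<open>Col\<close>, respectively
  \<open>Row\<close>, of every tableau, thanks to the root or to a border cell.\<close>

lemma tableau_le_iff:
  assumes S: "fb_tableau n S" and T: "fb_tableau n T"
  shows "tableau_le n S T \<longleftrightarrow> encode n S \<subseteq> encode n T"
proof -
  have Col: "Col n S \<subseteq> Col n T \<longleftrightarrow> (\<forall>(i, j) \<in> core n. has_above S (i, j) \<longrightarrow> has_above T (i, j))"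
  proof (intro iffI ballI subsetI; clarify)
    fix i j assume sub: "Col n S \<subseteq> Col n T" and ij: "(i, j) \<in> core n" and "has_above S (i, j)"
    then obtain k where k: "k < i" "(k, j) \<in> S" by auto
    then have "(i - 1, j) \<in> board n" using ij tableau_board[OF S, of k j] by auto
    moreover have "k \<le> i - 1" using k by simp
    ultimately have "(i - 1, j) \<in> Col n S" using k Col_iff[OF S] by blast
    then obtain k' where "k' \<le> i - 1" "(k', j) \<in> T" using sub Col_iff[OF T] by blast
    then show "has_above T (i, j)" using ij by (auto intro!: exI[of _ k'])
  next
    fix i j assume above: "\<forall>(i, j) \<in> core n. has_above S (i, j) \<longrightarrow> has_above T (i, j)"
      and "(i, j) \<in> Col n S"
    then obtain k where k: "(i, j) \<in> board n" "k \<le> i" "(k, j) \<in> S" using Col_iff[OF S] by blast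
    have "\<exists>k \<le> i. (k, j) \<in> T"
    proof (cases "j = n \<or> i = j + 1 \<and> 2 \<le> i")
      case True
      moreover have "1 \<le> i" using k(1) by auto
      moreover have "(i, j) \<in> T" if "i = j + 1" "2 \<le> i"
        using tableau_border[OF T, of i] k(1) that by auto
      ultimately show ?thesis using tableau_root[OF T] by blast
    next
      case False
      then have "(i + 1, j) \<in> core n" using k(1) by auto
      moreover have "has_above S (i + 1, j)" using k by (auto intro!: exI[of _ k])
      ultimately have "has_above T (i + 1, j)" using above by blast
      then show ?thesis by (auto simp: less_Suc_eq_le)
    qed
    then show "(i, j) \<in> Col n T" using k Col_iff[OF T] by blast
  qed
  have Row: "Row n T \<subseteq> Row n S \<longleftrightarrow> (\<forall>(i, j) \<in> core n. has_left T (i, j) \<longrightarrow> has_left S (i, j))"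
  proof (intro iffI ballI subsetI; clarify)
    fix i j assume sub: "Row n T \<subseteq> Row n S" and ij: "(i, j) \<in> core n" and "has_left T (i, j)"
    then obtain k where k: "j < k" "(i, k) \<in> T" by auto
    then have "(i, j + 1) \<in> board n" using ij tableau_board[OF T, of i k] by auto
    moreover have "j + 1 \<le> k" using k by simp
    ultimately have "(i, j + 1) \<in> Row n T" using k Row_iff[OF T] by blast
    then obtain k' where "k' \<ge> j + 1" "(i, k') \<in> S" using sub Row_iff[OF S] by blast
    then show "has_left S (i, j)" using ij by (auto intro!: exI[of _ k'])
  next
    fix i j assume left: "\<forall>(i, j) \<in> core n. has_left T (i, j) \<longrightarrow> has_left S (i, j)"
      and "(i, j) \<in> Row n T"
    then obtain k where k: "(i, j) \<in> board n" "k \<ge> j" "(i, k) \<in> T" using Row_iff[OF T] by blast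
    have "\<exists>k \<ge> j. (i, k) \<in> S"
    proof (cases "i = 1 \<or> i = j + 1")
      case True
      moreover have "j \<le> n" using k(1) by auto
      moreover have "(i, j) \<in> S" if "i = j + 1" "i \<noteq> 1"
        using tableau_border[OF S, of i] k(1) that by auto
      ultimately show ?thesis using tableau_root[OF S] by (cases "i = 1") auto
    next
      case False
      then have "(i, j - 1) \<in> core n" using k(1) by auto
      moreover have "has_left T (i, j - 1)" using k False by (auto intro!: exI[of _ k])
      ultimately have "has_left S (i, j - 1)" using left by blast
      then obtain l where "j - 1 < l" "(i, l) \<in> S" by auto
      then show ?thesis by (auto intro!: exI[of _ l])
    qed
    then show "(i, j) \<in> Row n S" using k Row_iff[OF S] by blast
  qed
  have dots: "(\<forall>c. free_cell n S c \<and> free_cell n T c \<and> is_dot n S c \<longrightarrow> is_dot n T c) \<longleftrightarrow>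
    (\<forall>(i, j) \<in> core n. has_above S (i, j) \<and> has_left S (i, j) \<and> has_above T (i, j) \<and> has_left T (i, j) \<and>
       (i, j) \<in> S \<longrightarrow> (i, j) \<in> T)"
    using is_dot_iff[OF S] is_dot_iff[OF T]
    by (auto simp: free_cell_iff[OF S] free_cell_iff[OF T] simp del: has_above_iff has_left_iff core_iff)
  \<comment> \<open>\<open>Gamma\<close> reports on the left only where something is above. The
    left-arrow of \<open>S\<close> in this row meets both conditions, so its \<open>Gamma\<close>
    carries the missing information over to \<open>T\<close>.\<close>
  have left: "has_left S (i, j)"
    if sub: "encode n S \<subseteq> encode n T" and ij: "(i, j) \<in> core n" and Tl: "has_left T (i, j)" for i j
  proof (rule ccontr)
    assume nl: "\<not> has_left S (i, j)"
    obtain k where k: "(i, k) \<in> S" "k < n \<Longrightarrow> (Gamma, i, k) \<in> encode n S"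
      using Gamma_leftmost[OF S ij] by metis
    have "k \<le> j" using nl k(1) not_le by auto
    then have "(Gamma, i, k) \<in> encode n T" using k ij sub by auto
    then show False using Tl \<open>k \<le> j\<close> by (auto simp: encode_iff)
  qed
  show ?thesis
  proof
    assume le: "tableau_le n S T"
    show "encode n S \<subseteq> encode n T"
    proof clarify
      fix x i j assume q: "(x, i, j) \<in> encode n S"
      then have ij: "(i, j) \<in> core n" by (auto simp: encode_iff)
      \<comment> \<open>For \<open>Delta\<close>, a nonempty cell to the left in \<open>T\<close>
        yields one in \<open>S\<close> by the condition on \<open>Row\<close>; then the cell is free
        in both tableaux and its dot in \<open>S\<close> passes to \<open>T\<close>.\<close>
      show "(x, i, j) \<in> encode n T"
        using le q ij unfolding tableau_le_def Col Row dots encode_iff by blast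
    qed
  next
    assume sub: "encode n S \<subseteq> encode n T"
    have "has_above T (i, j)" if "(i, j) \<in> core n" "has_above S (i, j)" for i j
    proof -
      have "(Beta, i, j) \<in> encode n S" using that by (simp add: encode_iff)
      then have "(Beta, i, j) \<in> encode n T" using sub by blast
      then show ?thesis unfolding encode_iff by blast
    qed
    moreover have "(i, j) \<in> T"
      if ij: "(i, j) \<in> core n" and S: "has_above S (i, j)" "(i, j) \<in> S" and Tl: "has_left T (i, j)" for i j
    proof (cases "i = j + 1")
      case True
      then show ?thesis using tableau_border[OF T, of i] ij by simp
    next
      case False
      then have "(Delta, i, j) \<in> encode n S" using ij S by (simp add: encode_iff)
      then have "(Delta, i, j) \<in> encode n T" using sub by blast
      then show ?thesis using Tl unfolding encode_iff by blast
    qed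
    ultimately show "tableau_le n S T"
      unfolding tableau_le_def Col Row dots using left[OF sub] by blast
  qed
qed

text \<open>The two demanded elements are the nearest premises that produce
  \<open>(Gamma, i, j)\<close>. For \<open>i = j + 1\<close> row \<open>i\<close> has no cell at
  label \<open>j - 1\<close>, so nothing is demanded at the border.\<close>

definition dependency_closed :: "nat \<Rightarrow> (kind \<times> cell) set \<Rightarrow> bool" where
  "dependency_closed n U \<longleftrightarrow> U \<subseteq> atoms n \<and>
     (\<forall>(x, i, j) \<in> U. i \<le> j \<longrightarrow> (Gamma, i, j - 1) \<in> U \<and> (Beta, i + 1, j) \<in> U)"

lemma below_refl: "q \<in> atoms n \<Longrightarrow> q \<in> below n q"
  by (cases q) auto

lemma below_trans: "r \<in> below n q \<Longrightarrow> s \<in> below n r \<Longrightarrow> s \<in> below n q"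
  by (cases q; cases r; cases s) auto

lemma below_antisym: "r \<in> below n q \<Longrightarrow> q \<in> below n r \<Longrightarrow> r = q"
  by (cases q; cases r) auto

lemma below_atoms: "below n q \<subseteq> atoms n"
  unfolding below_def by (cases q) auto

text \<open>The two-premise rule combines two different columns, so it never fires within a single
  one.\<close>

lemma closed_set_column:
  assumes "F \<subseteq> atoms n" "\<forall>q \<in> F. below n q \<subseteq> F" "\<forall>(x, k, l) \<in> F. l = j"
  shows "closed_set n F"
proof -
  have "j' = j" if "(x, k, j') \<in> F" for x k j' using assms(3) that by blast
  then show ?thesis unfolding closed_set_def using assms(1,2) by (metis less_irrefl)
qed

lemma closed_set_atoms_UNIV: "closed_set n (atoms n)"
  unfolding closed_set_def using below_atoms by auto

lemma closed_set_below_self: "closed_set n (below n q)"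
proof (rule closed_set_column)
  show "\<forall>(x, k, l) \<in> below n q. l = snd (snd q)" by (cases q) auto
qed (use below_atoms below_trans in blast)+

lemma closed_set_below_minus: "closed_set n (below n q - {q})"
proof (rule closed_set_column)
  show "\<forall>(x, k, l) \<in> below n q - {q}. l = snd (snd q)" by (cases q) auto
  show "\<forall>r \<in> below n q - {q}. below n r \<subseteq> below n q - {q}"
    using below_trans below_antisym by blast
qed (use below_atoms in blast)

lemma closed_set_Un:
  assumes "closed_set n F" "closed_set n G"
    and "\<And>i j j'. (Gamma, i, j') \<in> F \<union> G \<Longrightarrow> j' < j \<Longrightarrow> (Beta, i + 1, j) \<notin> F \<union> G"
  shows "closed_set n (F \<union> G)"
proof -
  have "F \<union> G \<subseteq> atoms n" "\<forall>q \<in> F \<union> G. below n q \<subseteq> F \<union> G"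
    using assms(1,2) unfolding closed_set_def by blast+
  then show ?thesis using assms(3) unfolding closed_set_def by metis
qed

lemma closed_set_Inter:
  assumes "\<A> \<subseteq> {F. closed_set n F}" "\<A> \<noteq> {}"
  shows "closed_set n (\<Inter>\<A>)"
proof -
  have closed: "closed_set n F" if "F \<in> \<A>" for F using assms(1) that by blast
  have "\<Inter>\<A> \<subseteq> atoms n" using assms(2) closed unfolding closed_set_def by blast
  moreover have "below n q \<subseteq> \<Inter>\<A>" if "q \<in> \<Inter>\<A>" for q
    using that closed unfolding closed_set_def by blast
  moreover have "(Gamma, i, j) \<in> \<Inter>\<A>"
    if "(Gamma, i, j') \<in> \<Inter>\<A>" "j' < j" "(Beta, i + 1, j) \<in> \<Inter>\<A>" for i j j'
    using that closed unfolding closed_set_def by blast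
  ultimately show ?thesis unfolding closed_set_def by blast
qed

lemma closure_representation_esTam:
  assumes "n \<ge> 1"
  shows "closure_representation (esTam n) (encode n) (atoms n) {F. closed_set n F} (below n)"
proof
  have "inj_on (encode n) {T. fb_tableau n T}"
    by (rule inj_on_inverseI[of _ "decode n"]) (simp add: decode_encode)
  moreover have "encode n ` {T. fb_tableau n T} = {F. closed_set n F}"
    using closed_set_encode encode_decode fb_tableau_decode[OF _ assms] by (force simp: image_iff)
  ultimately show "bij_betw (encode n) (carrier (esTam n)) {F. closed_set n F}"
    unfolding bij_betw_def esTam_def by simp
next
  fix q F assume "F \<in> {F. closed_set n F}" "q \<in> F"
  then show "below n q \<subseteq> F" by (simp add: closed_set_def)
next
  fix F assume "F \<in> {F. closed_set n F}"
  then show "F \<subseteq> atoms n" by (simp add: closed_set_def)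
next
  fix \<A> assume "\<A> \<subseteq> {F. closed_set n F}" "\<A> \<noteq> {}"
  then show "\<Inter>\<A> \<in> {F. closed_set n F}" using closed_set_Inter by simp
next
  fix S T assume "S \<in> carrier (esTam n)" "T \<in> carrier (esTam n)"
  then show "S \<sqsubseteq>\<^bsub>esTam n\<^esub> T \<longleftrightarrow> encode n S \<subseteq> encode n T"
    by (simp add: esTam_def tableau_le_iff)
qed (simp_all add: finite_atoms closed_set_atoms_UNIV closed_set_below_self closed_set_below_minus
    below_refl)

text \<open>Repeating the demand for the nearest \<open>Gamma\<close> leads along the row to all
  \<open>Gamma\<close> premises further right.\<close>

lemma dependency_closed_Gamma:
  assumes U: "dependency_closed n U"
  shows "(x, i, j) \<in> U \<Longrightarrow> k < j \<Longrightarrow> i \<le> k + 1 \<Longrightarrow> (Gamma, i, k) \<in> U"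
proof (induction j arbitrary: x)
  case (Suc j)
  have "(Gamma, i, j) \<in> U"
    using U Suc.prems unfolding dependency_closed_def by fastforce
  then show ?case using Suc.IH Suc.prems by (cases "k = j") auto
qed simp

text \<open>Admissibility turns out to be dependency closure. Necessity tests admissibility on the
  smallest down-closed set containing both nearest premises; sufficiency follows derivations through
  the closure system.\<close>

lemma card_congruences_esTam:
  assumes "n \<ge> 1"
  shows "card (carrier (congruence_lattice (esTam n))) = card {U. dependency_closed n U}"
proof -
  interpret closure_representation "esTam n" "encode n" "atoms n" "{F. closed_set n F}" "below n"
    using assms by (rule closure_representation_esTam)
  have closed_cl: "closed_set n (cl X)" if "X \<subseteq> atoms n" for X
    using cl_mem[OF that] by simp
  have "dependency_closed n U" if adm: "admissible U" for U
  proof -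
    have sub: "U \<subseteq> atoms n" using adm by (simp add: admissible_def)
    have "(Gamma, i, j - 1) \<in> U \<and> (Beta, i + 1, j) \<in> U" if q: "(x, i, j) \<in> U" and ij: "i \<le> j" for x i j
    proof -
      define A B where "A = below n (Gamma, i, j - 1)" and "B = below n (Beta, i + 1, j)"
      have bounds: "2 \<le> i" "j < n" using q sub by auto
      have "down_closed (A \<union> B)"
        unfolding A_def B_def by (intro down_closed_Un_closed) (auto simp: closed_set_below_self)
      then have "cl (A \<union> B) \<inter> U \<subseteq> cl ((A \<union> B) \<inter> U)" using adm unfolding admissible_def by blast
      moreover have "(x, i, j) \<in> cl (A \<union> B)"
      proof -
        have closed: "closed_set n (cl (A \<union> B))"
          unfolding A_def B_def using below_atoms by (intro closed_cl) blast
        have "(Gamma, i, j - 1) \<in> A" "(Beta, i + 1, j) \<in> B"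
          unfolding A_def B_def using bounds ij by auto
        then have "(Gamma, i, j) \<in> cl (A \<union> B)"
          using closed_set_Gamma[OF closed, of i "j - 1" j Beta "i + 1"] cl_upper[of "A \<union> B"] bounds ij
          by auto
        then show ?thesis using closed_set_below[OF closed, of Gamma i j "(x, i, j)"] q sub by auto
      qed
      ultimately have mem: "(x, i, j) \<in> cl ((A \<union> B) \<inter> U)" using q by blast
      have notin: "(x, i, j) \<notin> A \<union> B" unfolding A_def B_def using ij bounds by auto
      \<comment> \<open>The element \<open>(x, i, j)\<close> arises only by closing
        \<open>A \<union> B\<close>. A closed set between \<open>(A \<union> B) \<inter> U\<close>
        and \<open>A \<union> B\<close> would therefore keep it out of the closure of the
        trace.\<close>
      have contradiction: False if "(A \<union> B) \<inter> U \<subseteq> C" "closed_set n C" "C \<subseteq> A \<union> B" for C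
        using cl_least[of C "(A \<union> B) \<inter> U"] that mem notin by blast
      show ?thesis
      proof (rule ccontr)
        assume *: "\<not> ?thesis"
        show False
        proof (cases "(Gamma, i, j - 1) \<in> U")
          case False
          \<comment> \<open>The deleted element was the only \<open>Gamma\<close>, so the rule has
            no first premise left.\<close>
          let ?C = "(A - {(Gamma, i, j - 1)}) \<union> B"
          have "closed_set n ?C"
            unfolding A_def B_def
            by (intro closed_set_Un closed_set_below_minus closed_set_below_self) auto
          then show False using contradiction[of ?C] False by blast
        next
          case True
          \<comment> \<open>The only \<open>Gamma\<close> is at \<open>(i, j - 1)\<close>, and the
            deleted element was its only partner for the rule.\<close>
          let ?C = "A \<union> (B - {(Beta, i + 1, j)})"
          have "closed_set n ?C"
            unfolding A_def B_def
            by (intro closed_set_Un closed_set_below_minus closed_set_below_self) auto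
          then show False using contradiction[of ?C] * True by blast
        qed
      qed
    qed
    then show ?thesis unfolding dependency_closed_def using sub by blast
  qed
  moreover have "admissible U" if U: "dependency_closed n U" for U
  proof -
    have sub: "U \<subseteq> atoms n" using U by (simp add: dependency_closed_def)
    have "cl X \<inter> U \<subseteq> cl (X \<inter> U)" if X: "down_closed X" for X
    proof -
      \<comment> \<open>An induction over the closure in disguise: \<open>Z\<close> collects the
        atoms whose retained consequences follow from \<open>X \<inter> U\<close>. It contains
        \<open>X\<close> and is closed, hence contains \<open>cl X\<close>.\<close>
      define Z where "Z = {q \<in> atoms n. \<forall>r \<in> below n q. r \<in> U \<longrightarrow> r \<in> cl (X \<inter> U)}"
      have closed: "closed_set n (cl (X \<inter> U))" using sub by (intro closed_cl) blast
      have "X \<subseteq> Z" using X cl_upper[of "X \<inter> U"] unfolding down_closed_def Z_def by blast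
      moreover have "closed_set n Z"
      proof -
        have "Z \<subseteq> atoms n" unfolding Z_def by blast
        moreover have "below n q \<subseteq> Z" if "q \<in> Z" for q
          using that below_trans below_atoms unfolding Z_def by blast
        moreover have "(Gamma, i, j) \<in> Z"
          if G: "(Gamma, i, j') \<in> Z" and j': "j' < j" and B: "(Beta, i + 1, j) \<in> Z" for i j j'
        proof -
          have bounds: "2 \<le> i" "i \<le> j' + 1" "j < n" using G B unfolding Z_def by auto
          have "(y, k, l) \<in> cl (X \<inter> U)" if r: "(y, k, l) \<in> below n (Gamma, i, j)" "(y, k, l) \<in> U" for y k l
          \<comment> \<open>Elements below the conclusion in lower rows are already below the
            \<open>Beta\<close> premise. One in row \<open>i\<close> that belongs to
            \<open>U\<close> pulls both premises into \<open>U\<close>, so the rule can be applied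
            inside \<open>cl (X \<inter> U)\<close>.\<close>
          proof (cases "k = i")
            case False
            then have "(y, k, l) \<in> below n (Beta, i + 1, j)" using r(1) by auto
            then show ?thesis using B r(2) unfolding Z_def by blast
          next
            case True
            then have l: "l = j" using r(1) by simp
            then have "(Gamma, i, j') \<in> U"
              using dependency_closed_Gamma[OF U r(2)] True j' bounds by simp
            then have 1: "(Gamma, i, j') \<in> cl (X \<inter> U)"
              using G below_refl[of "(Gamma, i, j')" n] unfolding Z_def by blast
            have "(Beta, i + 1, j) \<in> U"
              using U r(2) True l bounds j' unfolding dependency_closed_def by fastforce
            then have "(Beta, i + 1, j) \<in> cl (X \<inter> U)"
              using B below_refl[of "(Beta, i + 1, j)" n] unfolding Z_def by blast
            then have "(Gamma, i, j) \<in> cl (X \<inter> U)"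
              using closed_set_Gamma[OF closed 1 j'] by simp
            then show ?thesis using closed_set_below[OF closed] r(1) by blast
          qed
          then show ?thesis unfolding Z_def using bounds j' by auto
        qed
        ultimately show ?thesis unfolding closed_set_def by blast
      qed
      ultimately have "cl X \<subseteq> Z" using cl_least by blast
      then show ?thesis using below_refl unfolding Z_def by blast
    qed
    then show ?thesis unfolding admissible_def using sub by blast
  qed
  ultimately have "{U. admissible U} = {U. dependency_closed n U}" by blast
  then show ?thesis using card_congruences by simp
qed

section \<open>Counting by supports\<close>

definition order_ideal :: "nat \<Rightarrow> cell set \<Rightarrow> bool" where
  "order_ideal n I \<longleftrightarrow> I \<subseteq> core n \<and> (\<forall>(i, j) \<in> I. i \<le> j \<longrightarrow> (i, j - 1) \<in> I \<and> (i + 1, j) \<in> I)"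

text \<open>The demands read from the receiving side: the support cell \<open>(i, j + 1)\<close>
  asks for \<open>Gamma\<close> at \<open>(i, j)\<close>, and \<open>(i - 1, j)\<close> asks for
  \<open>Beta\<close> there.\<close>

definition choices :: "cell set \<Rightarrow> cell \<Rightarrow> kind set set" where
  "choices I = (\<lambda>(i, j). {K. K \<noteq> {} \<and> (Delta \<in> K \<longrightarrow> i \<le> j) \<and>
     ((i, j + 1) \<in> I \<longrightarrow> Gamma \<in> K) \<and> ((i - 1, j) \<in> I \<longrightarrow> Beta \<in> K)})"

lemma finite_core: "finite (core n)"
  by (rule finite_subset[of _ "{..n} \<times> {..n}"]) auto

lemma order_ideal_support:
  assumes "dependency_closed n U"
  shows "order_ideal n (snd ` U)"
  using assms unfolding dependency_closed_def order_ideal_def atoms_def by force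

text \<open>Once the support is fixed, each demand restricts the kinds at one cell only and depends
  on the support alone. The sets \<open>U\<close> are thus the families of independent
  choices.\<close>

lemma card_support_fibre:
  assumes I: "order_ideal n I"
  shows "card {U. dependency_closed n U \<and> snd ` U = I} = (\<Prod>c \<in> I. card (choices I c))"
proof -
  define to_choice where "to_choice U = restrict (\<lambda>c. {x. (x, c) \<in> U}) I" for U :: "(kind \<times> cell) set"
  define of_choice where "of_choice \<phi> = {(x, c). c \<in> I \<and> x \<in> \<phi> c}" for \<phi> :: "cell \<Rightarrow> kind set"
  have core: "(i, j) \<in> core n" if "(i, j) \<in> I" for i j
    using I that unfolding order_ideal_def by blast
  have "bij_betw to_choice {U. dependency_closed n U \<and> snd ` U = I} (Pi\<^sub>E I (choices I))"
  proof (rule bij_betw_byWitness[where f' = of_choice])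
    show "\<forall>U \<in> {U. dependency_closed n U \<and> snd ` U = I}. of_choice (to_choice U) = U"
      unfolding of_choice_def to_choice_def by force
    show "\<forall>\<phi> \<in> Pi\<^sub>E I (choices I). to_choice (of_choice \<phi>) = \<phi>"
    proof
      fix \<phi> assume \<phi>: "\<phi> \<in> Pi\<^sub>E I (choices I)"
      show "to_choice (of_choice \<phi>) = \<phi>"
        by (rule extensionalityI[of _ I]) (use \<phi> in \<open>auto simp: of_choice_def to_choice_def PiE_def\<close>)
    qed
    show "to_choice ` {U. dependency_closed n U \<and> snd ` U = I} \<subseteq> Pi\<^sub>E I (choices I)"
    proof clarify
      fix U assume U: "dependency_closed n U" and "I = snd ` U"
      have sub: "U \<subseteq> atoms n" using U by (simp add: dependency_closed_def)
      have dep: "(Gamma, i, j - 1) \<in> U \<and> (Beta, i + 1, j) \<in> U" if "(x, i, j) \<in> U" "i \<le> j" for x i j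
        using U that unfolding dependency_closed_def by blast
      have "{x. (x, i, j) \<in> U} \<in> choices (snd ` U) (i, j)" if ij: "(i, j) \<in> snd ` U" for i j
      proof -
        obtain y where "(y, i, j) \<in> U" using ij by force
        then have "(y, i, j) \<in> atoms n" using sub by blast
        then have bounds: "2 \<le> i" "i \<le> j + 1" by auto
        have "(Gamma, i, j) \<in> U" if "(i, j + 1) \<in> snd ` U"
        proof -
          obtain x where "(x, i, j + 1) \<in> U" using \<open>(i, j + 1) \<in> snd ` U\<close> by force
          then show ?thesis using dep[of x i "j + 1"] bounds by simp
        qed
        moreover have "(Beta, i, j) \<in> U" if "(i - 1, j) \<in> snd ` U"
        proof -
          obtain x where x: "(x, i - 1, j) \<in> U" using \<open>(i - 1, j) \<in> snd ` U\<close> by force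
          moreover have "i - 1 \<le> j" "i - 1 + 1 = i" using bounds by auto
          ultimately show ?thesis using dep[of x "i - 1" j] by simp
        qed
        moreover have "i \<le> j" if "(Delta, i, j) \<in> U" using subsetD[OF sub that] by simp
        ultimately show ?thesis unfolding choices_def using ij by auto
      qed
      then show "to_choice U \<in> Pi\<^sub>E (snd ` U) (choices (snd ` U))"
        unfolding to_choice_def \<open>I = snd ` U\<close> by auto
    qed
    show "of_choice ` Pi\<^sub>E I (choices I) \<subseteq> {U. dependency_closed n U \<and> snd ` U = I}"
    proof clarify
      fix \<phi> assume \<phi>: "\<phi> \<in> Pi\<^sub>E I (choices I)"
      have choice: "\<phi> (i, j) \<noteq> {}" "Delta \<in> \<phi> (i, j) \<Longrightarrow> i \<le> j"
        "(i, j + 1) \<in> I \<Longrightarrow> Gamma \<in> \<phi> (i, j)" "(i - 1, j) \<in> I \<Longrightarrow> Beta \<in> \<phi> (i, j)"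
        if "(i, j) \<in> I" for i j
        using PiE_mem[OF \<phi> that] unfolding choices_def by auto
      have "of_choice \<phi> \<subseteq> atoms n"
        using core choice(2) unfolding of_choice_def by (auto simp del: core_iff simp: atoms_def)
      moreover have "(Gamma, i, j - 1) \<in> of_choice \<phi> \<and> (Beta, i + 1, j) \<in> of_choice \<phi>"
        if "(x, i, j) \<in> of_choice \<phi>" "i \<le> j" for x i j
      proof -
        have ij: "(i, j) \<in> I" using that by (simp add: of_choice_def)
        then have "(i, j - 1) \<in> I" "(i + 1, j) \<in> I"
          using I \<open>i \<le> j\<close> unfolding order_ideal_def by blast+
        moreover have "j - 1 + 1 = j" using core[OF ij] that(2) by simp
        ultimately show ?thesis
          using choice(3)[of i "j - 1"] choice(4)[of "i + 1" j] ij unfolding of_choice_def by simp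
      qed
      ultimately have "dependency_closed n (of_choice \<phi>)" unfolding dependency_closed_def by blast
      moreover have "snd ` of_choice \<phi> = I" using choice(1) unfolding of_choice_def by force
      ultimately show "dependency_closed n (of_choice \<phi>) \<and> snd ` of_choice \<phi> = I" by blast
    qed
  qed
  then have "card {U. dependency_closed n U \<and> snd ` U = I} = card (Pi\<^sub>E I (choices I))"
    by (rule bij_betw_same_card)
  moreover have "finite I" using I finite_core finite_subset unfolding order_ideal_def by blast
  ultimately show ?thesis by (simp add: card_PiE)
qed

lemma card_dependency_closed:
  "card {U. dependency_closed n U} = (\<Sum>I | order_ideal n I. \<Prod>c \<in> I. card (choices I c))"
proof -
  have fin: "finite {U. dependency_closed n U}"
    by (rule finite_subset[of _ "Pow (atoms n)"]) (auto simp: dependency_closed_def finite_atoms)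
  have fin': "finite {I. order_ideal n I}"
    by (rule finite_subset[of _ "Pow (core n)"]) (auto simp: order_ideal_def finite_core simp del: core_iff)
  have supports: "(\<lambda>U. snd ` U) ` {U. dependency_closed n U} \<subseteq> {I. order_ideal n I}"
    using order_ideal_support by blast
  have "card {U. dependency_closed n U} =
      (\<Sum>I | order_ideal n I. card {U \<in> {U. dependency_closed n U}. snd ` U = I})"
    using sum.group[OF fin fin' supports, of "\<lambda>_. 1 :: nat"] by simp
  also have "\<dots> = (\<Sum>I | order_ideal n I. \<Prod>c \<in> I. card (choices I c))"
    by (rule sum.cong) (auto simp: card_support_fibre)
  finally show ?thesis .
qed

text \<open>Splits by membership of \<open>a\<close>; iterated, it lets the simplifier count the
  sets of kinds.\<close>

lemma card_Pow_insert_filter: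
  assumes "finite A" "a \<notin> A"
  shows "card {K \<in> Pow (insert a A). P K} =
    card {K \<in> Pow A. P K} + card {K \<in> Pow A. P (insert a K)}"
proof -
  have "{K \<in> Pow (insert a A). P K} =
      {K \<in> Pow A. P K} \<union> insert a ` {K \<in> Pow A. P (insert a K)}"
    by (auto simp: Pow_insert)
  moreover have "card (insert a ` {K \<in> Pow A. P (insert a K)}) = card {K \<in> Pow A. P (insert a K)}"
    by (intro card_image inj_onI) (metis (no_types, lifting) PowD insert_ident mem_Collect_eq subsetD assms(2))
  moreover have "{K \<in> Pow A. P K} \<inter> insert a ` {K \<in> Pow A. P (insert a K)} = {}"
    using assms(2) by blast
  ultimately show ?thesis using assms(1) by (simp add: card_Un_disjoint)
qed

lemma card_kind_sets:
  "card {K. K \<noteq> {} \<and> (Delta \<in> K \<longrightarrow> d) \<and> (g \<longrightarrow> Gamma \<in> K) \<and> (b \<longrightarrow> Beta \<in> K)} =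
    (if d then if g \<and> b then 2 else if g \<or> b then 4 else 7
     else if g \<and> b then 1 else if g \<or> b then 2 else 3)"
    (is "card {K. ?P K} = _")
proof -
  have kinds: "{Beta, Delta, Gamma} = UNIV"
    using kind.nchotomy by auto
  have "{K. ?P K} = {K \<in> Pow {Beta, Delta, Gamma}. ?P K}"
    unfolding kinds by simp
  moreover have "{K \<in> Pow {}. Q K} = (if Q {} then {{}} else {})" for Q :: "kind set \<Rightarrow> bool"
    by auto
  ultimately show ?thesis
    by (cases d; cases g; cases b) (simp_all only: card_Pow_insert_filter finite_insert finite.emptyI
        insert_iff empty_iff kind.distinct simp_thms if_True if_False card_eq_0_iff
        insert_not_empty card.empty card_insert_if, simp_all add: card_Pow flip: Pow_def)
qed

lemma card_choices:
  "card (choices I (i, j)) =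
    (if i \<le> j
     then if (i, j + 1) \<in> I \<and> (i - 1, j) \<in> I then 2 else if (i, j + 1) \<in> I \<or> (i - 1, j) \<in> I then 4 else 7
     else if (i, j + 1) \<in> I \<and> (i - 1, j) \<in> I then 1 else if (i, j + 1) \<in> I \<or> (i - 1, j) \<in> I then 2 else 3)"
  unfolding choices_def prod.case by (rule card_kind_sets)

section \<open>Order ideals as Dyck paths\<close>

text \<open>Rows and columns of the board become the two diagonal directions; border cells get
  height 1.\<close>

definition diamond :: "cell \<Rightarrow> nat \<times> int" where
  "diamond = (\<lambda>(i, j). (i + j - 1, int j - int i + 2))"

text \<open>The diamond of \<open>(i, j)\<close> has its top vertex at abscissa
  \<open>i + j - 1\<close> and height \<open>j - i + 3\<close>.\<close>

definition path_ideal :: "nat \<Rightarrow> int list \<Rightarrow> cell set" where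
  "path_ideal n p = {(i, j) \<in> core n. int j - int i + 3 \<le> path_height p (i + j - 1)}"

lemma path_height_0 [simp]: "path_height p 0 = 0"
  by (simp add: path_height_def)

lemma path_height_Suc: "a < length p \<Longrightarrow> path_height p (Suc a) = path_height p a + p ! a"
  by (simp add: path_height_def take_Suc_conv_app_nth)

context
  fixes n p
  assumes p: "p \<in> dyck_paths n"
begin

lemma dyck_length: "length p = 2 * n"
  using p by (simp add: dyck_paths_def)

lemma dyck_nonneg: "a \<le> 2 * n \<Longrightarrow> 0 \<le> path_height p a"
  using p by (simp add: dyck_paths_def)

lemma dyck_end: "path_height p (2 * n) = 0"
  using p by (simp add: dyck_paths_def)

lemma dyck_step:
  assumes "a < 2 * n"
  shows "\<bar>path_height p (Suc a) - path_height p a\<bar> = 1"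
proof -
  have "p ! a \<in> set p" using assms dyck_length by simp
  then have "p ! a \<in> {1, -1}" using p unfolding dyck_paths_def by blast
  then show ?thesis using path_height_Suc[of a p] assms dyck_length by auto
qed

lemma dyck_parity: "a \<le> 2 * n \<Longrightarrow> even (path_height p a + int a)"
proof (induction a)
  case (Suc a)
  then have "even (path_height p a + int a)" "\<bar>path_height p (Suc a) - path_height p a\<bar> = 1"
    using dyck_step by auto
  then show ?case by presburger
qed simp

lemma dyck_height_le: "a \<le> 2 * n \<Longrightarrow> path_height p a \<le> int a"
proof (induction a)
  case (Suc a)
  then show ?case using dyck_step[of a] by auto
qed simp

lemma dyck_height_le': "a \<le> 2 * n \<Longrightarrow> path_height p a \<le> 2 * int n - int a"
proof (induction a rule: inc_induct)
  case (step a)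
  then show ?case using dyck_step[of a] by auto
qed (simp add: dyck_end)

lemma cells_below_iff:
  "(a, h) \<in> cells_below p \<longleftrightarrow> a \<le> 2 * n \<and> 1 \<le> h \<and> odd (int a + h) \<and> h + 1 \<le> path_height p a"
  by (simp add: cells_below_def dyck_length)

lemma bij_betw_diamond: "bij_betw diamond (path_ideal n p) (cells_below p)"
proof (rule bij_betw_imageI)
  show "inj_on diamond (path_ideal n p)"
    unfolding inj_on_def diamond_def path_ideal_def by auto
  show "diamond ` path_ideal n p = cells_below p"
  proof (intro subset_antisym subsetI)
    fix c assume "c \<in> diamond ` path_ideal n p"
    then obtain i j where c: "c = (i + j - 1, int j - int i + 2)"
      and ij: "2 \<le> i" "i \<le> j + 1" "j < n" "int j - int i + 3 \<le> path_height p (i + j - 1)"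
      unfolding diamond_def path_ideal_def by auto
    have "odd (int (i + j - 1) + (int j - int i + 2))" using ij(1) by (simp add: of_nat_diff)
    then show "c \<in> cells_below p" unfolding c cells_below_iff using ij by auto
  next
    fix c assume "c \<in> cells_below p"
    then obtain a h where c: "c = (a, h)" and ah: "a \<le> 2 * n" "1 \<le> h" "odd (int a + h)"
        "h + 1 \<le> path_height p a"
      by (cases c) (auto simp: cells_below_iff)
    have bounds: "h + 1 \<le> int a" "int a + h + 1 \<le> 2 * int n"
      using dyck_height_le[OF ah(1)] dyck_height_le'[OF ah(1)] ah(4) by auto
    obtain m where m: "int a + h = 2 * m + 1" using ah(3) by (rule oddE)
    \<comment> \<open>The inverse of \<open>diamond\<close>: the label is half of
      \<open>a + h - 1\<close>. The slope bounds from both ends of the path place the cell in the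
      core.\<close>
    define i j where "i = nat (int a - m + 1)" and "j = nat m"
    have i: "int i = int a - m + 1" and j: "int j = m"
      unfolding i_def j_def using bounds ah(2) m by auto
    have "i + j - 1 = a" "int j - int i + 2 = h" using i j m by linarith+
    moreover have "2 \<le> i" "i \<le> j + 1" "j < n" using i j m bounds ah(2) by linarith+
    ultimately have "(i, j) \<in> path_ideal n p" "diamond (i, j) = c"
      unfolding path_ideal_def diamond_def using ah(4) c by auto
    then show "c \<in> diamond ` path_ideal n p" by (metis imageI)
  qed
qed

lemma order_ideal_path_ideal: "order_ideal n (path_ideal n p)"
proof -
  have "(i, j - 1) \<in> path_ideal n p \<and> (i + 1, j) \<in> path_ideal n p"
    if "(i, j) \<in> path_ideal n p" "i \<le> j" for i j
  proof -
    have ij: "2 \<le> i" "j < n" "int j - int i + 3 \<le> path_height p (i + j - 1)"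
      using that by (auto simp: path_ideal_def)
    define a where "a = i + j - 2"
    have a: "i + j - 1 = Suc a" "i + (j - 1) - 1 = a" "i + 1 + j - 1 = Suc (Suc a)" "Suc a < 2 * n"
      unfolding a_def using ij that(2) by auto
    have "int j - int i + 2 \<le> path_height p (i + (j - 1) - 1)"
      using dyck_step[of a] ij(3) a(4) unfolding a(1,2) by simp
    moreover have "int j - int i + 2 \<le> path_height p (i + 1 + j - 1)"
      using dyck_step[of "Suc a"] ij(3) a(4) unfolding a(1,3) by simp
    ultimately show ?thesis using ij that(2) by (auto simp: path_ideal_def of_nat_diff)
  qed
  then show ?thesis unfolding order_ideal_def path_ideal_def by blast
qed

text \<open>The neighbours \<open>(i, j + 1)\<close> and \<open>(i - 1, j)\<close> are the diamonds
  across the upper right and upper left edges. By parity and unit steps, such a neighbour fails to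
  be below the path exactly when the path runs along the shared edge.\<close>

lemma card_choices_path_ideal:
  assumes c: "c \<in> path_ideal n p"
  shows "card (choices (path_ideal n p) c) = cell_weight p (diamond c)"
proof -
  obtain i j where [simp]: "c = (i, j)" by (cases c)
  define a h where "a = i + j - 1" and "h = int j - int i + 2"
  have ij: "2 \<le> i" "i \<le> j + 1" "j < n" "h + 1 \<le> path_height p a"
    using c by (auto simp: path_ideal_def a_def h_def)
  have a: "1 \<le> a" "a < 2 * n" "int a = int i + int j - 1" using ij(1-3) by (auto simp: a_def)
  have heights: "\<bar>path_height p (a + 1) - path_height p a\<bar> = 1" "\<bar>path_height p a - path_height p (a - 1)\<bar> = 1"
    "even (path_height p (a + 1) + int (a + 1))" "even (path_height p (a - 1) + int (a - 1))"
    using dyck_step[of a] dyck_step[of "a - 1"] dyck_parity[of "a + 1"] dyck_parity[of "a - 1"] a by auto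
  have parity: "even (int a + 1 + h)" unfolding h_def a(3) by simp
  have right: "(i, j + 1) \<in> path_ideal n p \<longleftrightarrow> \<not> upper_right_on_path p (a, h)"
  proof -
    have "(i, j + 1) \<in> path_ideal n p \<longleftrightarrow> j + 1 < n \<and> h + 2 \<le> path_height p (a + 1)"
      unfolding path_ideal_def a_def h_def using ij(1-3) by (auto simp: algebra_simps)
    \<comment> \<open>A neighbour outside the core would lie above the highest Dyck path, so the
      height condition alone already keeps it inside.\<close>
    moreover have "j + 1 < n" if "h + 2 \<le> path_height p (a + 1)"
      using dyck_height_le'[of "a + 1"] that a h_def by simp
    moreover have "h + 2 \<le> path_height p (a + 1) \<longleftrightarrow> \<not> upper_right_on_path p (a, h)"
      unfolding upper_right_on_path_def prod.case using heights(1,3) ij(4) parity by presburger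
    ultimately show ?thesis by blast
  qed
  have left: "(i - 1, j) \<in> path_ideal n p \<longleftrightarrow> \<not> upper_left_on_path p (a, h)"
  proof -
    have "i - 1 + j - 1 = a - 1" using a_def ij(1) by simp
    then have "(i - 1, j) \<in> path_ideal n p \<longleftrightarrow> 3 \<le> i \<and> h + 2 \<le> path_height p (a - 1)"
      unfolding path_ideal_def h_def using ij(1-3) by (auto simp: of_nat_diff)
    moreover have "3 \<le> i" if "h + 2 \<le> path_height p (a - 1)"
    proof -
      have "a - 1 \<le> 2 * n" "int (a - 1) = int a - 1" using a by auto
      then show ?thesis using dyck_height_le[of "a - 1"] that a(3) unfolding h_def by linarith
    qed
    moreover have "int (a - 1) = int a - 1" using a by simp
    then have "h + 2 \<le> path_height p (a - 1) \<longleftrightarrow> \<not> upper_left_on_path p (a, h)"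
      unfolding upper_left_on_path_def prod.case using heights(2,4) ij(4) parity by presburger
    ultimately show ?thesis by blast
  qed
  have "h = 1 \<longleftrightarrow> \<not> i \<le> j" using ij h_def by auto
  moreover have "diamond c = (a, h)" by (simp add: diamond_def a_def h_def)
  ultimately show ?thesis
    using left right
    by (auto simp: card_choices cell_weight_def corner_cell_def boundary_cell_def)
qed

lemma path_weight_eq: "path_weight p = (\<Prod>c \<in> path_ideal n p. card (choices (path_ideal n p) c))"
proof -
  have "path_weight p = (\<Prod>c \<in> path_ideal n p. cell_weight p (diamond c))"
    unfolding path_weight_def by (rule prod.reindex_bij_betw[OF bij_betw_diamond, symmetric])
  then show ?thesis by (simp add: card_choices_path_ideal)
qed

end

text \<open>Where \<open>p\<close> is higher than \<open>q\<close>, parity makes the gap at least 2,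
  so the diamond whose top vertex is on \<open>p\<close> there is not below
  \<open>q\<close>.\<close>

lemma dyck_height_mono:
  assumes p: "p \<in> dyck_paths n" and q: "q \<in> dyck_paths n"
    and sub: "path_ideal n p \<subseteq> path_ideal n q" and a: "a \<le> 2 * n"
  shows "path_height p a \<le> path_height q a"
proof (rule ccontr)
  assume less: "\<not> path_height p a \<le> path_height q a"
  let ?h = "path_height p a - 1"
  have "even (path_height p a + path_height q a)"
    using dyck_parity[OF p a] dyck_parity[OF q a] by presburger
  then have "path_height q a + 2 \<le> path_height p a" using less by presburger
  then have "1 \<le> ?h" using dyck_nonneg[OF q a] by simp
  moreover have "odd (int a + ?h)" using dyck_parity[OF p a] by presburger
  ultimately have "(a, ?h) \<in> cells_below p" using cells_below_iff[OF p] a by simp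
  then have "(a, ?h) \<in> cells_below q"
    using bij_betw_diamond[OF p] bij_betw_diamond[OF q] sub unfolding bij_betw_def by blast
  then show False using less cells_below_iff[OF q] by simp
qed

lemma inj_on_path_ideal: "inj_on (path_ideal n) (dyck_paths n)"
proof (rule inj_onI)
  fix p q assume p: "p \<in> dyck_paths n" and q: "q \<in> dyck_paths n" and "path_ideal n p = path_ideal n q"
  then have heights: "path_height p a = path_height q a" if "a \<le> 2 * n" for a
    using dyck_height_mono that by (metis order_antisym order_refl)
  show "p = q"
  proof (rule nth_equalityI)
    show "length p = length q" using dyck_length p q by metis
    fix a assume "a < length p"
    then show "p ! a = q ! a"
      using path_height_Suc[of a p] path_height_Suc[of a q] heights[of a] heights[of "Suc a"]
        dyck_length[OF p] dyck_length[OF q] by simp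
  qed
qed

lemma path_height_map_diff:
  assumes "a \<le> m"
  shows "path_height (map (\<lambda>a. \<eta> (Suc a) - \<eta> a) [0..<m]) a = \<eta> a - \<eta> 0"
  using assms
proof (induction a)
  case (Suc a)
  then show ?case using path_height_Suc[of a "map (\<lambda>a. \<eta> (Suc a) - \<eta> a) [0..<m]"] by simp
qed simp

text \<open>Move along row \<open>i\<close> to label \<open>l\<close>, then down that column to row
  \<open>k\<close>; the bound \<open>k \<le> l + 1\<close> keeps both walks away from the border
  until their ends.\<close>

lemma order_ideal_mem:
  assumes I: "order_ideal n I" and ij: "(i, j) \<in> I" and "i \<le> k" "l \<le> j" "k \<le> l + 1"
  shows "(k, l) \<in> I"
proof -
  have ideal: "(i, j - 1) \<in> I" "(i + 1, j) \<in> I" if "(i, j) \<in> I" "i \<le> j" for i j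
    using I that unfolding order_ideal_def by blast+
  have "(i, l) \<in> I"
    using \<open>l \<le> j\<close>
  proof (induction l rule: inc_induct)
    case (step m)
    then show ?case using ideal(1)[of i "Suc m"] assms(3,5) by simp
  qed (rule ij)
  show ?thesis
    using \<open>i \<le> k\<close> \<open>k \<le> l + 1\<close>
  proof (induction k rule: dec_induct)
    case (step m)
    then show ?case using ideal(2)[of m l] by simp
  qed (rule \<open>(i, l) \<in> I\<close>)
qed

text \<open>
  The path of an order ideal is its upper envelope. At abscissas without cells, its height is the
  smallest one of the right parity.
\<close>

lemma path_ideal_surj:
  assumes I: "order_ideal n I"
  shows "I \<in> path_ideal n ` dyck_paths n"
proof -
  define H where "H a = insert (int (a mod 2)) {int j - int i + 3 | i j. (i, j) \<in> I \<and> i + j = Suc a}" for a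
  define \<eta> where "\<eta> a = Max (H a)" for a
  have core: "2 \<le> i \<and> i \<le> j + 1 \<and> j < n" if "(i, j) \<in> I" for i j
    using I that unfolding order_ideal_def by auto
  have fin: "finite (H a)" for a
  proof -
    have "finite I" using I finite_core finite_subset unfolding order_ideal_def by blast
    moreover have "H a \<subseteq> insert (int (a mod 2)) ((\<lambda>(i, j). int j - int i + 3) ` I)"
      unfolding H_def by force
    ultimately show ?thesis by (meson finite.insertI finite_imageI finite_subset)
  qed
  have ge: "x \<le> \<eta> a" if "x \<in> H a" for x a
    unfolding \<eta>_def using fin that by (rule Max_ge)
  have attained: "\<eta> a = int (a mod 2) \<or> (\<exists>i j. (i, j) \<in> I \<and> i + j = Suc a \<and> \<eta> a = int j - int i + 3)" for a
  proof -
    have "\<eta> a \<in> H a" unfolding \<eta>_def by (rule Max_in[OF fin]) (simp add: H_def)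
    then show ?thesis unfolding H_def by blast
  qed
  have ge_mod: "int (a mod 2) \<le> \<eta> a" for a by (rule ge) (simp add: H_def)
  have ge_cell: "int j - int i + 3 \<le> \<eta> a" if "(i, j) \<in> I" "i + j = Suc a" for i j a
    by (rule ge) (use that H_def in blast)
  have parity: "even (\<eta> a + int a)" for a
    using attained[of a]
  proof
    assume "\<eta> a = int (a mod 2)"
    then show ?thesis by presburger
  next
    assume "\<exists>i j. (i, j) \<in> I \<and> i + j = Suc a \<and> \<eta> a = int j - int i + 3"
    then obtain i j where "i + j = Suc a" "\<eta> a = int j - int i + 3" by blast
    moreover have "int i + int j = int a + 1"
      using \<open>i + j = Suc a\<close> by (metis of_nat_add of_nat_Suc add.commute)
    ultimately have "\<eta> a + int a = 2 * (int j + 1)" by simp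
    then show ?thesis by simp
  qed
  have step_up: "\<eta> (Suc a) \<le> \<eta> a + 1" for a
    using attained[of "Suc a"]
  proof
    assume "\<eta> (Suc a) = int (Suc a mod 2)"
    then show ?thesis using ge_mod[of a] by presburger
  next
    assume "\<exists>i j. (i, j) \<in> I \<and> i + j = Suc (Suc a) \<and> \<eta> (Suc a) = int j - int i + 3"
    then obtain i j where ij: "(i, j) \<in> I" "i + j = Suc (Suc a)" "\<eta> (Suc a) = int j - int i + 3" by blast
    show ?thesis
    proof (cases "i \<le> j")
      case True
      then have "(i, j - 1) \<in> I" by (intro order_ideal_mem[OF I ij(1)]) auto
      then show ?thesis using ge_cell[of i "j - 1" a] ij True core[OF ij(1)] by simp
    next
      case False
      \<comment> \<open>A border diamond has its top at height 2 and the neighbouring abscissas are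
        odd, so the default height 1 there is high enough.\<close>
      then have i: "i = j + 1" using core[OF ij(1)] by simp
      then have "a mod 2 = 1" using ij(2) by presburger
      then show ?thesis using ij(3) i ge_mod[of a] by simp
    qed
  qed
  have step_down: "\<eta> a \<le> \<eta> (Suc a) + 1" for a
    using attained[of a]
  proof
    assume "\<eta> a = int (a mod 2)"
    then show ?thesis using ge_mod[of "Suc a"] by presburger
  next
    assume "\<exists>i j. (i, j) \<in> I \<and> i + j = Suc a \<and> \<eta> a = int j - int i + 3"
    then obtain i j where ij: "(i, j) \<in> I" "i + j = Suc a" "\<eta> a = int j - int i + 3" by blast
    show ?thesis
    proof (cases "i \<le> j")
      case True
      then have "(i + 1, j) \<in> I" by (intro order_ideal_mem[OF I ij(1)]) auto
      then show ?thesis using ge_cell[of "i + 1" j "Suc a"] ij by simp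
    next
      case False
      then have i: "i = j + 1" using core[OF ij(1)] by simp
      then have "Suc a mod 2 = 1" using ij(2) by presburger
      then show ?thesis using ij(3) i ge_mod[of "Suc a"] by simp
    qed
  qed
  have start: "\<eta> 0 = 0" and finish: "\<eta> (2 * n) = 0"
    using attained[of 0] attained[of "2 * n"] core by fastforce+
  have cell_iff: "(i, j) \<in> I \<longleftrightarrow> int j - int i + 3 \<le> \<eta> (i + j - 1)" if ij: "(i, j) \<in> core n" for i j
  proof
    assume "(i, j) \<in> I"
    then show "int j - int i + 3 \<le> \<eta> (i + j - 1)" using ge_cell ij by simp
  next
    assume le: "int j - int i + 3 \<le> \<eta> (i + j - 1)"
    have "2 \<le> \<eta> (i + j - 1)" using le ij by simp
    moreover have "(i + j - 1) mod 2 < 2" by simp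
    ultimately have "\<eta> (i + j - 1) \<noteq> int ((i + j - 1) mod 2)" by linarith
    then obtain k l where kl: "(k, l) \<in> I" "k + l = Suc (i + j - 1)" "\<eta> (i + j - 1) = int l - int k + 3"
      using attained by blast
    \<comment> \<open>Both cells have the same abscissa and \<open>(k, l)\<close> is at least as
      high, so \<open>(i, j)\<close> lies vertically below it.\<close>
    then have "k \<le> i" "j \<le> l" using le ij by auto
    then show "(i, j) \<in> I" using order_ideal_mem[OF I kl(1)] ij by simp
  qed
  define p where "p = map (\<lambda>a. \<eta> (Suc a) - \<eta> a) [0..<2 * n]"
  have height: "path_height p a = \<eta> a" if "a \<le> 2 * n" for a
    using path_height_map_diff[OF that, of \<eta>] start unfolding p_def by simp
  have "\<eta> (Suc a) - \<eta> a \<in> {1, -1}" for a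
  proof -
    have "odd (\<eta> (Suc a) - \<eta> a)" using parity[of a] parity[of "Suc a"] by presburger
    then have "\<eta> (Suc a) - \<eta> a \<noteq> 0" by (metis even_zero)
    then show ?thesis using step_up[of a] step_down[of a] by auto
  qed
  then have "set p \<subseteq> {1, -1}" unfolding p_def by auto
  moreover have "0 \<le> \<eta> a" for a using ge_mod[of a] by simp
  ultimately have "p \<in> dyck_paths n"
    unfolding dyck_paths_def using height finish by (simp add: p_def)
  moreover have "path_ideal n p = I"
  proof -
    have "(i, j) \<in> path_ideal n p \<longleftrightarrow> (i, j) \<in> I" for i j
    proof (cases "(i, j) \<in> core n")
      case True
      then have "i + j - 1 \<le> 2 * n" by auto
      then show ?thesis
        using True cell_iff[OF True] height[of "i + j - 1"] by (simp add: path_ideal_def)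
    next
      case False
      then show ?thesis using I unfolding order_ideal_def path_ideal_def by blast
    qed
    then show ?thesis by auto
  qed
  ultimately show ?thesis by blast
qed

lemma bij_betw_path_ideal: "bij_betw (path_ideal n) (dyck_paths n) {I. order_ideal n I}"
  by (rule bij_betw_imageI[OF inj_on_path_ideal])
    (use order_ideal_path_ideal path_ideal_surj in auto)

theorem theorem9p6:
  fixes n :: nat
  assumes "n \<ge> 1"
  shows "card (carrier (congruence_lattice (esTam n))) = (\<Sum>p \<in> dyck_paths n. path_weight p)"
proof -
  have "card (carrier (congruence_lattice (esTam n))) =
      (\<Sum>I | order_ideal n I. \<Prod>c \<in> I. card (choices I c))"
    using card_congruences_esTam[OF assms] card_dependency_closed by simp
  also have "\<dots> = (\<Sum>p \<in> dyck_paths n. \<Prod>c \<in> path_ideal n p. card (choices (path_ideal n p) c))"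
    by (rule sum.reindex_bij_betw[OF bij_betw_path_ideal, symmetric])
  also have "\<dots> = (\<Sum>p \<in> dyck_paths n. path_weight p)"
    by (rule sum.cong) (simp_all add: path_weight_eq)
  finally show ?thesis .
qed

end
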